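(* Let $X$ be an infinite-dimensional complex Banach space and let $F \in \mathcal{B}(X)$ with $F^{n}$ of finite rank for some $n \in \mathbb{N}$. (1) If $T \in \mathcal{B}(X)$ is semi-B-Fredholm and commutes with $F$, then (a) $\dim (\mathcal{R}(T^{\infty})+\mathcal{R}((T+F)^{\infty}))/(\mathcal{R}(T^{\infty})\cap\mathcal{R}((T+F)^{\infty}))<\infty$; (b) $\dim (\overline{\mathcal{N}(T^{\infty})}+\overline{\mathcal{N}((T+F)^{\infty})})/(\overline{\mathcal{N}(T^{\infty})}\cap\overline{\mathcal{N}((T+F)^{\infty})})<\infty$. (2) If $T \in \mathcal{B}(X)$ is upper (resp. lower) semi-B-Fredholm and commutes with $F$, then $T+F$ is also upper (resp. lower) semi-B-Fredholm and $\operatorname{ind}(T+F)=\operatorname{ind}(T)$.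
   Context: $\mathcal{B}(X)$ is the algebra of bounded linear operators on $X$. For $S\in\mathcal{B}(X)$, $\mathcal{R}(S^\infty)=\bigcap_{n\ge1}\mathcal{R}(S^n)$ (hyperrange) and $\mathcal{N}(S^\infty)=\bigcup_{n\ge1}\mathcal{N}(S^n)$ (hyperkernel); overline denotes closure. An operator $S$ is upper (resp. lower) semi-Fredholm if $\mathcal{R}(S)$ is closed and $\dim\mathcal{N}(S)<\infty$ (resp. $\operatorname{codim}\mathcal{R}(S)<\infty$), with index $\operatorname{ind}(S)=\dim\mathcal{N}(S)-\operatorname{codim}\mathcal{R}(S)$. $S_n$ denotes the restriction of $S$ to $\mathcal{R}(S^n)$ as a map $\mathcal{R}(S^n)\to\mathcal{R}(S^n)$. $S$ is upper (resp. lower) semi-B-Fredholm if there is $n$ with $\mathcal{R}(S^n)$ closed and $S_n$ upper (resp. lower) semi-Fredholm; semi-B-Fredholm means upper or lower semi-B-Fredholm. For such $S$, $\operatorname{ind}(S):=\operatorname{ind}(S_n)$ for any $n$ with $\mathcal{R}(S^n)$ closed and $S_n$ semi-Fredholm (independent of the choice of $n$). *)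

theory Defs
  imports "HOL-Analysis.Analysis"
begin

class complex_banach = banach +
  fixes scaleC :: "complex \<Rightarrow> 'a \<Rightarrow> 'a"
  assumes scaleC_add_right: "scaleC a (x + y) = scaleC a x + scaleC a y"
    and scaleC_add_left: "scaleC (a + b) x = scaleC a x + scaleC b x"
    and scaleC_scaleC: "scaleC a (scaleC b x) = scaleC (a * b) x"
    and scaleC_one: "scaleC 1 x = x"
    and scaleC_of_real: "scaleC (complex_of_real r) x = scaleR r x"
    and norm_scaleC: "norm (scaleC a x) = cmod a * norm x"

definition cspan :: "'a::complex_banach set \<Rightarrow> 'a set" where
  "cspan S = module.span scaleC S"

definition fin_cdim :: "'a::complex_banach set \<Rightarrow> bool" where
  "fin_cdim S \<longleftrightarrow> (\<exists>B. finite B \<and> S \<subseteq> cspan B)"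

text \<open>Dimension of the quotient N/M (for M \<subseteq> N subspaces): the least number of
vectors which together with M span N; \<infinity> if no finite number suffices.
In particular qdim V {0} is the dimension of V.\<close>
definition qdim :: "'a::complex_banach set \<Rightarrow> 'a set \<Rightarrow> enat" where
  "qdim N M = (if \<exists>S. finite S \<and> N \<subseteq> cspan (M \<union> S)
     then enat (LEAST k. \<exists>S. finite S \<and> card S = k \<and> N \<subseteq> cspan (M \<union> S))
     else \<infinity>)"

definition bop :: "('a::complex_banach \<Rightarrow> 'a) \<Rightarrow> bool" where
  "bop T \<longleftrightarrow> bounded_linear T \<and> (\<forall>c x. T (scaleC c x) = scaleC c (T x))"

definition hyperrange :: "('a::complex_banach \<Rightarrow> 'a) \<Rightarrow> 'a set" where
  "hyperrange T = (\<Inter>n\<in>{1..}. range (T ^^ n))"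

definition hyperkernel :: "('a::complex_banach \<Rightarrow> 'a) \<Rightarrow> 'a set" where
  "hyperkernel T = (\<Union>n\<in>{1..}. {x. (T ^^ n) x = 0})"

text \<open>Semi-Fredholm properties of the restriction of T to an invariant subspace V,
viewed as an operator V \<rightarrow> V.\<close>
definition upper_sf_on :: "'a set \<Rightarrow> ('a::complex_banach \<Rightarrow> 'a) \<Rightarrow> bool" where
  "upper_sf_on V T \<longleftrightarrow> closedin (top_of_set V) (T ` V) \<and> qdim {x\<in>V. T x = 0} {0} < \<infinity>"

definition lower_sf_on :: "'a set \<Rightarrow> ('a::complex_banach \<Rightarrow> 'a) \<Rightarrow> bool" where
  "lower_sf_on V T \<longleftrightarrow> closedin (top_of_set V) (T ` V) \<and> qdim V (T ` V) < \<infinity>"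

definition ind_on :: "'a set \<Rightarrow> ('a::complex_banach \<Rightarrow> 'a) \<Rightarrow> ereal" where
  "ind_on V T = ereal_of_enat (qdim {x\<in>V. T x = 0} {0}) - ereal_of_enat (qdim V (T ` V))"

definition upper_sbf :: "('a::complex_banach \<Rightarrow> 'a) \<Rightarrow> bool" where
  "upper_sbf T \<longleftrightarrow> (\<exists>n. closed (range (T ^^ n)) \<and> upper_sf_on (range (T ^^ n)) T)"

definition lower_sbf :: "('a::complex_banach \<Rightarrow> 'a) \<Rightarrow> bool" where
  "lower_sbf T \<longleftrightarrow> (\<exists>n. closed (range (T ^^ n)) \<and> lower_sf_on (range (T ^^ n)) T)"

definition sbf :: "('a::complex_banach \<Rightarrow> 'a) \<Rightarrow> bool" where
  "sbf T \<longleftrightarrow> upper_sbf T \<or> lower_sbf T"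

text \<open>Index of a semi-B-Fredholm operator: ind(T_n) for the least admissible n
(independent of the choice of admissible n).\<close>
definition bind :: "('a::complex_banach \<Rightarrow> 'a) \<Rightarrow> ereal" where
  "bind T = ind_on (range (T ^^ (LEAST n. closed (range (T ^^ n)) \<and>
      (upper_sf_on (range (T ^^ n)) T \<or> lower_sf_on (range (T ^^ n)) T)))) T"

end

theory Submission
  imports Defs
begin

text \<open>
  Write \<open>G = T + F\<close>. Expanding powers, \<open>G\<^sup>k\<^sup>+\<^sup>n = T\<^sup>k A + F\<^sup>n B\<close> with \<open>A\<close>, \<open>B\<close> in the algebra
  generated by \<open>T\<close> and \<open>F\<close>, and symmetrically with \<open>T\<close> and \<open>G\<close> exchanged. Hence the ranges of the
  powers of \<open>T\<close> and \<open>G\<close> interlace up to the finite-dimensional range of \<open>F\<^sup>n\<close>, and the kernels of the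
  powers interlace on the finite-codimensional kernel of \<open>F\<^sup>n\<close>; this gives (1).

  The index equality is pure linear algebra. The index of a restriction does not change when the
  invariant subspace changes by finitely many dimensions, so one may work on \<open>V = R(T\<^sup>k)\<close>; there the
  snake lemma along \<open>V \<supseteq> F V \<supseteq> F\<^sup>2 V \<supseteq> \<dots>\<close> compares \<open>T\<close> and \<open>G\<close>, which agree on the quotients.

  Closedness of \<open>R(G\<^sup>j)\<close> comes from Neubauer's lemma. In the lower case \<open>R(G\<^sup>j)\<close> has finite codimension
  in a closed space. In the upper case \<open>G\<^sup>j V\<close> is closed because \<open>T\<^sup>j\<^sup>+\<^sup>n = A G\<^sup>j\<close> on the kernel of \<open>F\<^sup>n\<close>, so
  \<open>R(G\<^sup>j) + N(T\<^sup>k)\<close>, the preimage of \<open>G\<^sup>j V\<close> under \<open>T\<^sup>k\<close>, is closed, while \<open>R(G\<^sup>j) \<inter> N(T\<^sup>k)\<close> has finite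
  dimension.
\<close>

section \<open>Complex subspaces\<close>

lemma span_scaleC: "module.span scaleC = cspan"
  by (simp add: fun_eq_iff cspan_def)

text \<open>The rewrite lets library facts about linear spans apply to \<open>cspan\<close>, the
  constant behind \<open>qdim\<close> and \<open>fin_cdim\<close>.\<close>

interpretation cvs: vector_space "scaleC :: complex \<Rightarrow> 'a::complex_banach \<Rightarrow> 'a"
  rewrites "module.span scaleC = cspan"
  by unfold_locales
    (simp_all add: scaleC_add_right scaleC_add_left scaleC_scaleC scaleC_one span_scaleC)

abbreviation csubspace :: "'a::complex_banach set \<Rightarrow> bool" where
  "csubspace \<equiv> module.subspace scaleC"

abbreviation clinear :: "('a::complex_banach \<Rightarrow> 'b::complex_banach) \<Rightarrow> bool" where
  "clinear \<equiv> Vector_Spaces.linear scaleC scaleC"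

lemma clinear_iff:
  "clinear f \<longleftrightarrow> (\<forall>x y. f (x + y) = f x + f y) \<and> (\<forall>c x. f (scaleC c x) = scaleC c (f x))"
  by (simp add: Vector_Spaces.linear_iff cvs.vector_space_axioms)

interpretation cvp: vector_space_pair
  "scaleC :: complex \<Rightarrow> 'a::complex_banach \<Rightarrow> 'a"
  "scaleC :: complex \<Rightarrow> 'b::complex_banach \<Rightarrow> 'b"
  rewrites "module.span (scaleC :: complex \<Rightarrow> 'a \<Rightarrow> 'a) = cspan"
    and "module.span (scaleC :: complex \<Rightarrow> 'b \<Rightarrow> 'b) = cspan"
  by unfold_locales (simp_all add: span_scaleC)

lemma csubspace_sum_iff:
  assumes "csubspace A" "csubspace B"
  shows "x \<in> cspan (A \<union> B) \<longleftrightarrow> (\<exists>a\<in>A. \<exists>b\<in>B. x = a + b)"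
  using assms by (auto simp: cvs.span_Un cvs.span_eq_iff[THEN iffD2])

lemma cspan_Un_cspan: "cspan (cspan A \<union> B) = cspan (A \<union> B)"
  by (simp add: cvs.span_Un cvs.span_span)

lemma cspan_Un_csubspace_iff:
  assumes "csubspace A"
  shows "x \<in> cspan (A \<union> B) \<longleftrightarrow> (\<exists>a\<in>A. \<exists>b\<in>cspan B. x = a + b)"
  using assms by (auto simp: cvs.span_Un cvs.span_eq_iff[THEN iffD2])

lemma finite_subset_cspan:
  assumes "finite D" "D \<subseteq> cspan A"
  shows "\<exists>C\<subseteq>A. finite C \<and> D \<subseteq> cspan C"
  using assms
proof (induction D)
  case (insert d D)
  then obtain C where C: "C \<subseteq> A" "finite C" "D \<subseteq> cspan C"
    by auto
  from insert.prems have "d \<in> cspan A"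
    by simp
  then obtain t where t: "finite t" "t \<subseteq> A" "d \<in> cspan t"
    unfolding cvs.span_explicit by blast
  have "insert d D \<subseteq> cspan (C \<union> t)"
    using C(3) t(3) cvs.span_mono[of C "C \<union> t"] cvs.span_mono[of t "C \<union> t"] by auto
  with C t show ?case
    by (intro exI[of _ "C \<union> t"]) auto
qed auto

section \<open>Dimensions of quotients\<close>

text \<open>Steinitz exchange relative to \<open>BM\<close>: finitely many vectors \<open>C'\<close>
  of \<open>BM\<close> suffice to express a finite \<open>D \<subseteq> BN - BM\<close> through
  \<open>S\<close>. Comparing the independent set \<open>C' \<union> D\<close> with the spanning set
  \<open>C' \<union> S\<close> leaves \<open>card D \<le> card S\<close>.\<close>

lemma card_basis_difference_le:
  assumes ind: "cvs.independent BN" and sub: "BM \<subseteq> BN"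
    and S: "finite S" "BN \<subseteq> cspan (BM \<union> S)"
  shows "finite (BN - BM) \<and> card (BN - BM) \<le> card S"
proof -
  have bound: "card D \<le> card S" if D: "D \<subseteq> BN - BM" "finite D" for D
  proof -
    have "D \<subseteq> cspan (BM \<union> S)"
      using D S by auto
    then obtain C where C: "C \<subseteq> BM \<union> S" "finite C" "D \<subseteq> cspan C"
      using finite_subset_cspan[OF D(2)] by metis
    define C' where "C' = C \<inter> BM"
    have fin: "finite C'"
      using C by (simp add: C'_def)
    have "C \<subseteq> C' \<union> S"
      using C by (auto simp: C'_def)
    then have "D \<subseteq> cspan (C' \<union> S)"
      using C(3) cvs.span_mono[of C "C' \<union> S"] by auto
    then have "C' \<union> D \<subseteq> cspan (C' \<union> S)"
      using cvs.span_superset[of "C' \<union> S"] by auto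
    moreover have "cvs.independent (C' \<union> D)"
      using ind by (rule cvs.independent_mono) (use D sub in \<open>auto simp: C'_def\<close>)
    ultimately have "card (C' \<union> D) \<le> card (C' \<union> S)"
      using cvs.independent_span_bound[of "C' \<union> S" "C' \<union> D"] fin S(1) by auto
    also have "\<dots> \<le> card C' + card S"
      by (rule card_Un_le)
    finally show ?thesis
      using fin D by (subst (asm) card_Un_disjoint) (auto simp: C'_def)
  qed
  have "finite (BN - BM)"
  proof (rule ccontr)
    assume "infinite (BN - BM)"
    then obtain D where "finite D" "card D = Suc (card S)" "D \<subseteq> BN - BM"
      using infinite_arbitrarily_large by metis
    with bound[of D] show False
      by simp
  qed
  with bound[of "BN - BM"] show ?thesis
    by simp
qed

text \<open>Replaces the minimum in \<open>qdim\<close> by a count of basis vectors; additivity of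
  dimensions rests on this.\<close>

lemma qdim_basis:
  assumes ind: "cvs.independent BN" and sub: "BM \<subseteq> BN"
  shows "qdim (cspan BN) (cspan BM) = (if finite (BN - BM) then enat (card (BN - BM)) else \<infinity>)"
proof -
  have le: "finite (BN - BM) \<and> card (BN - BM) \<le> card S"
    if "finite S" "cspan BN \<subseteq> cspan (cspan BM \<union> S)" for S
    using that card_basis_difference_le[OF ind sub, of S] cvs.span_superset[of BN]
    by (auto simp: cspan_Un_cspan)
  show ?thesis
  proof (cases "finite (BN - BM)")
    case True
    have "BM \<union> (BN - BM) = BN"
      using sub by auto
    then have self: "cspan BN \<subseteq> cspan (cspan BM \<union> (BN - BM))"
      by (simp add: cspan_Un_cspan)
    have "(LEAST k. \<exists>S. finite S \<and> card S = k \<and> cspan BN \<subseteq> cspan (cspan BM \<union> S)) = card (BN - BM)"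
      by (rule Least_equality) (use self True le in auto)
    then show ?thesis
      using True self by (auto simp: qdim_def)
  next
    case False
    then show ?thesis
      using le by (auto simp: qdim_def)
  qed
qed

lemma relative_basis:
  assumes "csubspace M" "M \<subseteq> N"
  obtains BM BN where "cvs.independent BN" "BM \<subseteq> BN" "cspan BM = M" "BN \<subseteq> N" "N \<subseteq> cspan BN"
proof -
  obtain BM where BM: "BM \<subseteq> M" "cvs.independent BM" "M \<subseteq> cspan BM"
    using cvs.maximal_independent_subset by metis
  then have "cspan BM = M"
    using assms(1) cvs.span_minimal by blast
  moreover obtain BN where "BM \<subseteq> BN" "BN \<subseteq> N" "cvs.independent BN" "N \<subseteq> cspan BN"
    using cvs.maximal_independent_subset_extend[of BM N] BM assms by blast
  ultimately show ?thesis
    using that by blast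
qed

text \<open>Nested bases of \<open>C\<close>, \<open>B\<close> and \<open>A\<close> make the two
  differences disjoint, so their cardinalities add; infinite values are covered.\<close>

lemma qdim_trans:
  assumes "csubspace A" "csubspace B" "csubspace C" "C \<subseteq> B" "B \<subseteq> A"
  shows "qdim A C = qdim A B + qdim B C"
proof -
  obtain BC BB where B: "cvs.independent BB" "BC \<subseteq> BB" "cspan BC = C" "BB \<subseteq> B" "B \<subseteq> cspan BB"
    using relative_basis[of C B] assms by metis
  obtain BA where A: "BB \<subseteq> BA" "BA \<subseteq> A" "cvs.independent BA" "A \<subseteq> cspan BA"
    using cvs.maximal_independent_subset_extend[of BB A] B assms by blast
  have span: "cspan BB = B" "cspan BA = A"
    using A B assms cvs.span_minimal by (metis subset_antisym)+
  have eq: "BA - BC = (BA - BB) \<union> (BB - BC)" and disj: "(BA - BB) \<inter> (BB - BC) = {}"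
    using A B by auto
  have "qdim A C = (if finite (BA - BC) then enat (card (BA - BC)) else \<infinity>)"
    using qdim_basis[of BA BC] A B span by auto
  moreover have "qdim A B = (if finite (BA - BB) then enat (card (BA - BB)) else \<infinity>)"
    using qdim_basis[of BA BB] A B span by auto
  moreover have "qdim B C = (if finite (BB - BC) then enat (card (BB - BC)) else \<infinity>)"
    using qdim_basis[of BB BC] A B span by auto
  ultimately show ?thesis
    using disj by (auto simp: eq card_Un_disjoint)
qed

lemma qdim_le_card: "finite S \<Longrightarrow> N \<subseteq> cspan (M \<union> S) \<Longrightarrow> qdim N M \<le> enat (card S)"
  by (auto simp: qdim_def intro!: Least_le)

lemma qdim_finite_iff: "qdim N M < \<infinity> \<longleftrightarrow> (\<exists>S. finite S \<and> N \<subseteq> cspan (M \<union> S))"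
  by (auto simp: qdim_def)

lemma qdim_attained:
  assumes "qdim N M = enat k"
  obtains S where "finite S" "card S = k" "N \<subseteq> cspan (M \<union> S)"
proof -
  have ex: "\<exists>k S. finite S \<and> card S = k \<and> N \<subseteq> cspan (M \<union> S)"
    using assms by (auto simp: qdim_def split: if_splits)
  then have "k = (LEAST k. \<exists>S. finite S \<and> card S = k \<and> N \<subseteq> cspan (M \<union> S))"
    using assms by (auto simp: qdim_def split: if_splits)
  then show ?thesis
    using LeastI_ex[OF ex] that by blast
qed

text \<open>First isomorphism theorem: \<open>f\<close> induces an isomorphism from A modulo the
  preimage of W onto (W + f(A))/W. All later dimension counts for kernels and images go through
  it.\<close>

lemma qdim_vimage:
  fixes f :: "'a::complex_banach \<Rightarrow> 'b::complex_banach"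
  assumes f: "clinear f" and A: "csubspace A" and W: "csubspace W"
  shows "qdim (cspan (W \<union> f ` A)) W = qdim A {x \<in> A. f x \<in> W}"
proof (rule antisym)
  let ?M = "{x \<in> A. f x \<in> W}"
  have M: "csubspace ?M"
    using A W f by (auto simp: cvs.subspace_def clinear_iff cvp.linear_0)
  show "qdim (cspan (W \<union> f ` A)) W \<le> qdim A ?M"
  proof (cases "qdim A ?M")
    case (enat k)
    then obtain S where S: "finite S" "card S = k" "A \<subseteq> cspan (?M \<union> S)"
      by (rule qdim_attained)
    have "f ` A \<subseteq> cspan (f ` (?M \<union> S))"
      using S(3) by (metis cvp.linear_span_image f image_mono)
    also have "\<dots> \<subseteq> cspan (W \<union> f ` S)"
      by (rule cvs.span_mono) auto
    finally have "cspan (W \<union> f ` A) \<subseteq> cspan (W \<union> f ` S)"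
      by (intro cvs.span_minimal cvs.subspace_span) (auto intro: cvs.span_base)
    then have "qdim (cspan (W \<union> f ` A)) W \<le> enat (card (f ` S))"
      using S by (intro qdim_le_card) auto
    also have "\<dots> \<le> enat k"
      using S card_image_le by auto
    finally show ?thesis
      using enat by simp
  qed auto
  show "qdim A ?M \<le> qdim (cspan (W \<union> f ` A)) W"
  proof (cases "qdim (cspan (W \<union> f ` A)) W")
    case (enat k)
    obtain BW where BW: "BW \<subseteq> W" "cvs.independent BW" "W \<subseteq> cspan BW"
      using cvs.maximal_independent_subset by metis
    \<comment> \<open>Extending inside the generating set, not inside its span, forces the new basis
      vectors to be images of elements of \<open>A\<close>, which can then be lifted to
      \<open>C\<close>.\<close>
    obtain B where B: "BW \<subseteq> B" "B \<subseteq> W \<union> f ` A" "cvs.independent B" "W \<union> f ` A \<subseteq> cspan B"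
      using cvs.maximal_independent_subset_extend[of BW "W \<union> f ` A"] BW by blast
    have sp: "cspan BW = W" "cspan B = cspan (W \<union> f ` A)"
      using BW W B cvs.span_minimal cvs.subspace_span cvs.span_superset
       apply blast
      using B(2,4) cvs.span_minimal cvs.subspace_span cvs.span_mono by (metis subset_antisym)
    have k: "finite (B - BW)" "card (B - BW) = k"
      using qdim_basis[OF B(3,1)] enat by (auto simp: sp split: if_splits)
    have "(B - BW) \<inter> W = {}"
    proof (rule ccontr)
      assume "(B - BW) \<inter> W \<noteq> {}"
      then obtain b where b: "b \<in> B" "b \<notin> BW" "b \<in> cspan BW"
        using sp by auto
      then have "b \<in> cspan (B - {b})"
        using B(1) cvs.span_mono[of BW "B - {b}"] by blast
      with b B(3) show False
        by (auto simp: cvs.dependent_def)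
    qed
    then have "B - BW \<subseteq> f ` A"
      using B by auto
    then obtain C where C: "C \<subseteq> A" "inj_on f C" "B - BW = f ` C"
      by (meson subset_image_inj)
    have fin: "finite C" "card C = k"
      using k C card_image[of f C] finite_imageD by auto
    have "A \<subseteq> cspan (?M \<union> C)"
    proof
      fix x assume x: "x \<in> A"
      then have "f x \<in> cspan B"
        using B by auto
      also have "B = BW \<union> f ` C"
        using C B by auto
      finally obtain w c where wc: "w \<in> W" "c \<in> cspan C" "f x = w + f c"
        by (auto simp: cvs.span_Un sp cvp.linear_span_image[OF f])
      have "c \<in> A"
        using wc C A cvs.span_minimal by blast
      then have "x - c \<in> ?M"
        using x A wc f by (auto simp: cvs.subspace_diff cvp.linear_diff)
      then show "x \<in> cspan (?M \<union> C)"
        using wc(2) M by (auto simp: cspan_Un_csubspace_iff intro!: bexI[of _ "x - c"] bexI[of _ c])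
    qed
    then have "qdim A ?M \<le> enat (card C)"
      using fin by (intro qdim_le_card) auto
    then show ?thesis
      using fin enat by simp
  qed auto
qed

lemma csubspace_UNIV: "csubspace UNIV"
  by (rule cvs.subspace_UNIV)

lemma csubspace_image: "clinear f \<Longrightarrow> csubspace A \<Longrightarrow> csubspace (f ` A)"
  by (rule cvp.linear_subspace_image)

lemma csubspace_vimage: "clinear f \<Longrightarrow> csubspace A \<Longrightarrow> csubspace W \<Longrightarrow> csubspace {x \<in> A. f x \<in> W}"
  by (auto simp: cvs.subspace_def clinear_iff cvp.linear_0)

lemma csubspace_kernel: "clinear f \<Longrightarrow> csubspace A \<Longrightarrow> csubspace {x \<in> A. f x = 0}"
  using csubspace_vimage[of f A "{0}"] by (simp add: cvs.subspace_single_0)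

lemma cspan_UnI: "a \<in> A \<Longrightarrow> x - a \<in> B \<Longrightarrow> x \<in> cspan (A \<union> B)"
  using cvs.span_add[of a "A \<union> B" "x - a"] by (simp add: cvs.span_base)

lemma clinear_id: "clinear (\<lambda>x. x)"
  by (simp add: clinear_iff)

lemma qdim_Un_Int:
  assumes "csubspace A" "csubspace W"
  shows "qdim (cspan (W \<union> A)) W = qdim A (A \<inter> W)"
  using qdim_vimage[OF clinear_id assms] by (simp add: Int_def)

definition fin_mod :: "'a::complex_banach set \<Rightarrow> 'a set \<Rightarrow> bool" where
  "fin_mod A B \<longleftrightarrow> (\<exists>S. finite S \<and> A \<subseteq> cspan (B \<union> S))"

lemma qdim_finite: "qdim A B < \<infinity> \<longleftrightarrow> fin_mod A B"
  unfolding fin_mod_def by (rule qdim_finite_iff)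

lemma qdim_infinite: "qdim A B = \<infinity> \<longleftrightarrow> \<not> fin_mod A B"
  using qdim_finite[of A B] by (simp only: enat_ord_simps) blast

lemma fin_mod_zero: "fin_mod A {0} \<longleftrightarrow> fin_cdim A"
  by (simp add: fin_mod_def fin_cdim_def)

lemma fin_mod_subset: "A \<subseteq> B \<Longrightarrow> fin_mod A B"
  using cvs.span_superset[of B] by (force simp: fin_mod_def)

lemma fin_mod_trans:
  assumes "fin_mod A B" "fin_mod B C"
  shows "fin_mod A C"
proof -
  from assms obtain S T where S: "finite S" "A \<subseteq> cspan (B \<union> S)" and T: "finite T" "B \<subseteq> cspan (C \<union> T)"
    by (auto simp: fin_mod_def)
  have "cspan (B \<union> S) \<subseteq> cspan (C \<union> (T \<union> S))"
  proof (rule cvs.span_minimal)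
    show "B \<union> S \<subseteq> cspan (C \<union> (T \<union> S))"
      using T(2) cvs.span_mono[of "C \<union> T" "C \<union> (T \<union> S)"] cvs.span_superset[of "C \<union> (T \<union> S)"]
      by auto
  qed (rule cvs.subspace_span)
  with S T show ?thesis
    unfolding fin_mod_def by (intro exI[of _ "T \<union> S"]) auto
qed

lemma fin_mod_mono: "fin_mod A B \<Longrightarrow> A' \<subseteq> A \<Longrightarrow> B \<subseteq> B' \<Longrightarrow> fin_mod A' B'"
  using fin_mod_trans[of A' A B'] fin_mod_trans[of A B B'] by (simp add: fin_mod_subset)

lemma fin_mod_Un:
  assumes "fin_mod A C" "fin_mod B C"
  shows "fin_mod (cspan (A \<union> B)) C"
proof -
  from assms obtain S T where S: "finite S" "A \<subseteq> cspan (C \<union> S)" and T: "finite T" "B \<subseteq> cspan (C \<union> T)"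
    by (auto simp: fin_mod_def)
  have "cspan (A \<union> B) \<subseteq> cspan (C \<union> (S \<union> T))"
  proof (rule cvs.span_minimal)
    show "A \<union> B \<subseteq> cspan (C \<union> (S \<union> T))"
      using S T cvs.span_mono[of "C \<union> T" "C \<union> (S \<union> T)"] cvs.span_mono[of "C \<union> S" "C \<union> (S \<union> T)"]
      by auto
  qed (rule cvs.subspace_span)
  with S T show ?thesis
    unfolding fin_mod_def by (intro exI[of _ "S \<union> T"]) auto
qed

lemma fin_mod_Un_fin_cdim:
  assumes "fin_cdim E"
  shows "fin_mod (cspan (A \<union> E)) A"
proof (rule fin_mod_Un)
  from assms obtain S where S: "finite S" "E \<subseteq> cspan S"
    by (auto simp: fin_cdim_def)
  then show "fin_mod E A"
    using cvs.span_mono[of S "A \<union> S"] by (auto simp: fin_mod_def)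
qed (simp add: fin_mod_subset)

lemma fin_mod_image:
  assumes "clinear f" "fin_mod A B"
  shows "fin_mod (f ` A) (f ` B)"
proof -
  from assms obtain S where S: "finite S" "A \<subseteq> cspan (B \<union> S)"
    by (auto simp: fin_mod_def)
  then have "f ` A \<subseteq> cspan (f ` B \<union> f ` S)"
    by (metis assms(1) cvp.linear_span_image image_Un image_mono)
  with S show ?thesis
    unfolding fin_mod_def by blast
qed

lemma fin_mod_vimage:
  "clinear f \<Longrightarrow> csubspace A \<Longrightarrow> csubspace W \<Longrightarrow> fin_mod (f ` A) W \<Longrightarrow> fin_mod A {x \<in> A. f x \<in> W}"
  using qdim_vimage[of f A W] fin_mod_Un[of W W "f ` A"] by (metis fin_mod_subset order_refl qdim_finite)

text \<open>The identity embeds (A \<inter> C)/(A \<inter> B \<inter> C) into (A + B)/B.\<close>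

lemma fin_mod_Int:
  "csubspace A \<Longrightarrow> csubspace B \<Longrightarrow> csubspace C \<Longrightarrow> fin_mod A B \<Longrightarrow> fin_mod (A \<inter> C) (B \<inter> C)"
  using fin_mod_vimage[OF clinear_id, of "A \<inter> C" B]
  by (auto simp: cvs.subspace_inter intro: fin_mod_mono)

lemma fin_cdim_subset: "fin_cdim A \<Longrightarrow> B \<subseteq> A \<Longrightarrow> fin_cdim B"
  by (auto simp: fin_cdim_def)

lemma fin_cdim_trans: "fin_mod A B \<Longrightarrow> fin_cdim B \<Longrightarrow> fin_cdim A"
  by (metis fin_mod_zero fin_mod_trans)

section \<open>Index of restrictions to invariant subspaces\<close>

text \<open>The snake lemma for \<open>0 \<rightarrow> W \<rightarrow> V \<rightarrow> V/W \<rightarrow> 0\<close>, written without subtraction.\<close>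

lemma index_snake:
  assumes S: "clinear S" and V: "csubspace V" and W: "csubspace W"
    and WV: "W \<subseteq> V" and SV: "S ` V \<subseteq> V" and SW: "S ` W \<subseteq> W"
  shows "qdim {x \<in> V. S x = 0} {0} + qdim W (S ` W) + qdim V (cspan (W \<union> S ` V))
       = qdim {x \<in> W. S x = 0} {0} + qdim V (S ` V) + qdim {x \<in> V. S x \<in> W} W"
proof -
  define N K where "N = {x \<in> V. S x = 0}" and "K = {x \<in> V. S x \<in> W}"
  have sub: "csubspace N" "csubspace K" "csubspace (S ` V)" "csubspace (S ` W)"
    using S V W by (simp_all add: N_def K_def csubspace_kernel csubspace_vimage csubspace_image)
  have NW: "N \<inter> W = {x \<in> W. S x = 0}"
    using WV by (auto simp: N_def)
  have NK: "N \<subseteq> K" and WK: "W \<subseteq> K"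
    using W WV SW by (auto simp: N_def K_def cvs.subspace_0)
  have WNK: "cspan (W \<union> N) \<subseteq> K"
    using NK WK sub by (intro cvs.span_minimal) auto
  have SK: "S ` K = S ` V \<inter> W"
    by (auto simp: K_def)
  have nul: "qdim N {0} = qdim N (N \<inter> W) + qdim {x \<in> W. S x = 0} {0}"
    using sub W qdim_trans[of N "N \<inter> W" "{0}"]
    by (simp add: NW[symmetric] cvs.subspace_inter cvs.subspace_0 cvs.subspace_single_0)
  have KW: "qdim K W = qdim K (cspan (W \<union> N)) + qdim N (N \<inter> W)"
    using qdim_trans[of K "cspan (W \<union> N)" W] sub W WNK cvs.span_superset[of "W \<union> N"]
    by (simp add: qdim_Un_Int)
  \<comment> \<open>The connecting map: \<open>S\<close> sends K onto S(V) \<inter> W, and modulo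
    S(W) the kernel of this map is W + N.\<close>
  have "{x \<in> K. S x \<in> S ` W} = cspan (W \<union> N)"
  proof (rule antisym)
    show "{x \<in> K. S x \<in> S ` W} \<subseteq> cspan (W \<union> N)"
    proof
      fix x assume "x \<in> {x \<in> K. S x \<in> S ` W}"
      then obtain w where w: "x \<in> V" "w \<in> W" "S x = S w"
        by (auto simp: K_def)
      then have "x - w \<in> N"
        using V WV S by (auto simp: N_def cvs.subspace_diff cvp.linear_diff)
      with w show "x \<in> cspan (W \<union> N)"
        by (intro cspan_UnI[of w])
    qed
    have "S x \<in> S ` W" if "x \<in> N" for x
      using that W by (auto simp: N_def cvs.subspace_0 cvp.linear_0[OF S] intro!: image_eqI[of _ _ 0])
    then show "cspan (W \<union> N) \<subseteq> {x \<in> K. S x \<in> S ` W}"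
      using NK WK sub by (intro cvs.span_minimal csubspace_vimage S) auto
  qed
  moreover have "cspan (S ` W \<union> S ` K) = S ` V \<inter> W"
    using SW WV sub W by (subst SK, subst cvs.span_eq_iff[THEN iffD2, symmetric, of "S ` V \<inter> W"])
      (auto simp: cvs.subspace_inter intro!: arg_cong[where f = cspan])
  ultimately have y: "qdim K (cspan (W \<union> N)) = qdim (S ` V \<inter> W) (S ` W)"
    using qdim_vimage[OF S sub(2,4)] by simp
  have dW: "qdim W (S ` W) = qdim W (S ` V \<inter> W) + qdim (S ` V \<inter> W) (S ` W)"
    using SW WV sub W by (intro qdim_trans cvs.subspace_inter) auto
  have "cspan (W \<union> S ` V) \<subseteq> V"
    using WV SV V by (intro cvs.span_minimal) auto
  then have dV: "qdim V (S ` V) = qdim V (cspan (W \<union> S ` V)) + qdim W (W \<inter> S ` V)"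
    using qdim_trans[of V "cspan (W \<union> S ` V)" "S ` V"] V cvs.span_superset[of "W \<union> S ` V"]
      qdim_Un_Int[of W "S ` V"] sub W by (simp add: Un_commute)
  \<comment> \<open>After these splittings both sides consist of the same five summands.\<close>
  show ?thesis
    unfolding N_def[symmetric] K_def[symmetric] nul KW y dW dV
    by (simp add: ac_simps Int_commute)
qed

text \<open>The map induced on the finite-dimensional quotient V/W has equal nullity and defect:
  each complements \<open>qdim ?L W\<close> to \<open>qdim V W\<close>. These two terms, being
  finite, cancel from the snake identity.\<close>

lemma index_invariant_fin_mod:
  assumes S: "clinear S" and V: "csubspace V" and W: "csubspace W"
    and WV: "W \<subseteq> V" and SV: "S ` V \<subseteq> V" and SW: "S ` W \<subseteq> W" and fin: "fin_mod V W"
  shows "qdim {x \<in> V. S x = 0} {0} + qdim W (S ` W) = qdim {x \<in> W. S x = 0} {0} + qdim V (S ` V)"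
proof -
  let ?K = "{x \<in> V. S x \<in> W}" and ?L = "cspan (W \<union> S ` V)"
  have K: "csubspace ?K" "W \<subseteq> ?K" "?K \<subseteq> V"
    using S V W WV SW by (auto simp: csubspace_vimage)
  have L: "W \<subseteq> ?L" "?L \<subseteq> V"
    using WV SV V cvs.span_superset[of "W \<union> S ` V"] cvs.span_minimal[of "W \<union> S ` V" V] by auto
  have "qdim V W = qdim ?L W + qdim ?K W"
    using qdim_trans[OF V K(1) W K(2,3)] qdim_vimage[OF S V W] by simp
  moreover have "qdim V W = qdim V ?L + qdim ?L W"
    using qdim_trans[OF V _ W L] by simp
  moreover have "qdim V W < \<infinity>"
    using fin by (simp only: qdim_finite)
  ultimately have "qdim ?K W = qdim V ?L" "qdim ?K W \<noteq> \<infinity>"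
    by (cases "qdim ?K W"; cases "qdim V ?L"; cases "qdim ?L W"; simp)+
  then show ?thesis
    using index_snake[OF S V W WV SV SW]
    by (auto simp: add.commute[of _ "qdim V ?L"] enat_add_left_cancel)
qed

text \<open>The index does not change from V to S(V). If V/S(V) is infinite-dimensional, both sides
  are infinite: a finite left side would make V finite modulo S(V) + N(S) with N(S)
  finite-dimensional, hence finite modulo S(V).\<close>

lemma index_range_step:
  assumes S: "clinear S" and V: "csubspace V" and SV: "S ` V \<subseteq> V"
  shows "qdim {x \<in> V. S x = 0} {0} + qdim (S ` V) (S ` S ` V)
       = qdim {x \<in> S ` V. S x = 0} {0} + qdim V (S ` V)"
proof (cases "fin_mod V (S ` V)")
  case True
  then show ?thesis
    using assms by (intro index_invariant_fin_mod csubspace_image) auto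
next
  case False
  have *: "cspan (S ` V \<union> S ` V) = S ` V" "{x \<in> V. S x \<in> S ` V} = V"
    using csubspace_image[OF S V] by (auto simp: cvs.span_eq_iff[THEN iffD2])
  have "qdim {x \<in> V. S x = 0} {0} + qdim (S ` V) (S ` S ` V) = \<infinity>"
  proof (rule ccontr)
    assume "\<not> ?thesis"
    then have fin: "fin_mod {x \<in> V. S x = 0} {0}" "fin_mod (S ` V) (S ` S ` V)"
      by (simp_all add: plus_eq_infty_iff_enat qdim_infinite)
    have sub: "csubspace (S ` V)" "csubspace (S ` S ` V)"
      using S V by (simp_all add: csubspace_image)
    have "fin_mod V {x \<in> V. S x \<in> S ` S ` V}"
      using fin_mod_vimage[OF S V sub(2) fin(2)] .
    moreover have "{x \<in> V. S x \<in> S ` S ` V} \<subseteq> cspan (S ` V \<union> {x \<in> V. S x = 0})"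
    proof
      fix x assume "x \<in> {x \<in> V. S x \<in> S ` S ` V}"
      then obtain w where w: "x \<in> V" "w \<in> S ` V" "S x = S w"
        by auto
      then have "x - w \<in> {x \<in> V. S x = 0}"
        using V SV S by (auto simp: cvs.subspace_diff cvp.linear_diff)
      with w show "x \<in> cspan (S ` V \<union> {x \<in> V. S x = 0})"
        by (intro cspan_UnI[of w])
    qed
    moreover have "fin_mod (cspan (S ` V \<union> {x \<in> V. S x = 0})) (S ` V)"
      using fin(1) by (intro fin_mod_Un_fin_cdim) (simp add: fin_mod_zero)
    ultimately have "fin_mod V (S ` V)"
      by (rule fin_mod_trans[OF _ fin_mod_trans[OF fin_mod_subset]])
    with False show False ..
  qed
  moreover have "qdim V (S ` V) = \<infinity>"
    using False by (simp add: qdim_infinite)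
  ultimately show ?thesis
    by simp
qed

section \<open>Commuting perturbations\<close>

lemma bop_clinear: "bop f \<Longrightarrow> clinear f"
  by (auto simp: bop_def clinear_iff bounded_linear.linear linear_add)

lemma bop_add: "bop f \<Longrightarrow> bop g \<Longrightarrow> bop (\<lambda>x. f x + g x)"
  by (auto simp: bop_def bounded_linear_add scaleC_add_right)

lemma bop_comp: "bop f \<Longrightarrow> bop g \<Longrightarrow> bop (\<lambda>x. f (g x))"
  by (auto simp: bop_def bounded_linear_compose)

lemma bop_uminus: "bop f \<Longrightarrow> bop (\<lambda>x. - f x)"
  by (auto simp: bop_def bounded_linear_minus)

lemma bop_zero: "bop (\<lambda>x. 0)"
  by (simp add: bop_def bounded_linear_zero)

lemma bop_id: "bop (\<lambda>x. x)"
  by (simp add: bop_def bounded_linear_ident)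

lemma bop_funpow: "bop f \<Longrightarrow> bop (f ^^ k)"
proof (induction k)
  case 0
  then show ?case
    using bop_id by (simp add: id_def)
next
  case (Suc k)
  then show ?case
    using bop_comp[of f "f ^^ k"] by (simp add: comp_def)
qed

lemma clinear_funpow:
  fixes f :: "'a::complex_banach \<Rightarrow> 'a"
  shows "clinear f \<Longrightarrow> clinear (f ^^ k)"
  by (induction k) (auto simp: clinear_iff)

lemma csubspace_range_funpow:
  fixes f :: "'a::complex_banach \<Rightarrow> 'a"
  shows "clinear f \<Longrightarrow> csubspace (range (f ^^ k))"
  by (intro csubspace_image clinear_funpow csubspace_UNIV)

lemma image_range_funpow:
  fixes f :: "'a \<Rightarrow> 'a"
  shows "f ` range (f ^^ k) = range (f ^^ Suc k)"
  by (auto simp: image_image)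

lemma funpow_image_range:
  fixes f :: "'a \<Rightarrow> 'a"
  shows "(f ^^ j) ` range (f ^^ k) = range (f ^^ (j + k))"
  by (simp add: funpow_add image_comp)

lemma range_funpow_mono:
  fixes f :: "'a \<Rightarrow> 'a"
  shows "j \<le> k \<Longrightarrow> range (f ^^ k) \<subseteq> range (f ^^ j)"
  using funpow_add[of j "k - j" f] by auto

lemma funpow_commute:
  fixes f g :: "'a \<Rightarrow> 'a"
  shows "(\<And>x. f (g x) = g (f x)) \<Longrightarrow> (f ^^ k) (g x) = g ((f ^^ k) x)"
  by (induction k) auto

text \<open>Within V, \<open>S\<close> maps N(S^(k+1)) into N(S^k), and the kernel of this map lies
  in N(S).\<close>

lemma fin_cdim_kernel_funpow:
  fixes S :: "'a::complex_banach \<Rightarrow> 'a"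
  assumes "clinear S" "csubspace V" "S ` V \<subseteq> V" "fin_cdim {x \<in> V. S x = 0}"
  shows "fin_cdim {x \<in> V. (S ^^ k) x = 0}"
proof (induction k)
  case 0
  have "{x \<in> V. (S ^^ 0) x = 0} \<subseteq> {x \<in> V. S x = 0}"
    using assms(1) by (auto simp: cvp.linear_0)
  then show ?case
    using assms(4) fin_cdim_subset by blast
next
  case (Suc k)
  let ?K = "{x \<in> V. (S ^^ Suc k) x = 0}"
  have "S ` ?K \<subseteq> {x \<in> V. (S ^^ k) x = 0}"
    using assms(3) by (auto simp: funpow_swap1)
  then have "fin_mod (S ` ?K) {0}"
    using Suc fin_cdim_subset by (auto simp: fin_mod_zero)
  then have "fin_mod ?K {x \<in> ?K. S x \<in> {0}}"
    using assms by (intro fin_mod_vimage csubspace_kernel clinear_funpow) (auto simp: cvs.subspace_single_0)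
  moreover have "fin_cdim {x \<in> ?K. S x \<in> {0}}"
    using assms(4) by (rule fin_cdim_subset) auto
  ultimately show ?case
    by (rule fin_cdim_trans)
qed

lemma fin_mod_funpow_image:
  fixes S :: "'a::complex_banach \<Rightarrow> 'a"
  assumes "clinear S" "fin_mod V (S ` V)"
  shows "fin_mod V ((S ^^ k) ` V)"
proof (induction k)
  case 0
  then show ?case
    by (simp add: fin_mod_subset)
next
  case (Suc k)
  have "fin_mod ((S ^^ k) ` V) ((S ^^ k) ` S ` V)"
    using assms by (intro fin_mod_image clinear_funpow)
  moreover have "(S ^^ k) ` S ` V = (S ^^ Suc k) ` V"
    by (simp only: funpow_Suc_right image_comp)
  ultimately show ?case
    using Suc fin_mod_trans by metis
qed

section \<open>Nullity, defect and stability of the index\<close>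

definition nul :: "'a set \<Rightarrow> ('a::complex_banach \<Rightarrow> 'a) \<Rightarrow> enat" where
  "nul V S = qdim {x \<in> V. S x = 0} {0}"

definition dfc :: "'a set \<Rightarrow> ('a::complex_banach \<Rightarrow> 'a) \<Rightarrow> enat" where
  "dfc V S = qdim V (S ` V)"

lemma ind_on_eq: "ind_on V S = ereal_of_enat (nul V S) - ereal_of_enat (dfc V S)"
  by (simp add: ind_on_def nul_def dfc_def)

lemma nul_infinite: "nul V S = \<infinity> \<longleftrightarrow> \<not> fin_cdim {x \<in> V. S x = 0}"
  by (simp add: nul_def qdim_infinite fin_mod_zero del: not_infinity_eq)

lemma dfc_infinite: "dfc V S = \<infinity> \<longleftrightarrow> \<not> fin_mod V (S ` V)"
  by (simp add: dfc_def qdim_infinite del: not_infinity_eq)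

text \<open>Index identities are kept as sums in \<open>enat\<close> and turned into differences in
  \<open>ereal\<close> only here. The finiteness hypotheses exclude the form infinity minus
  infinity; if one term is infinite, it is so on both sides and the indices are the same infinite
  value.\<close>

lemma ind_on_cong:
  assumes eq: "nul V S + dfc W R = nul W R + dfc V S"
    and nul: "nul V S = \<infinity> \<longleftrightarrow> nul W R = \<infinity>" and dfc: "dfc V S = \<infinity> \<longleftrightarrow> dfc W R = \<infinity>"
    and fin: "nul V S \<noteq> \<infinity> \<or> dfc V S \<noteq> \<infinity>"
  shows "ind_on V S = ind_on W R"
proof (cases "nul V S = \<infinity> \<or> dfc V S = \<infinity>")
  case True
  then show ?thesis
  proof
    assume inf: "nul V S = \<infinity>"
    then obtain d d' where "dfc V S = enat d" "dfc W R = enat d'"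
      using fin dfc by (metis not_infinity_eq)
    with inf nul show ?thesis
      by (simp add: ind_on_eq)
  next
    assume inf: "dfc V S = \<infinity>"
    then obtain d d' where "nul V S = enat d" "nul W R = enat d'"
      using fin nul by (metis not_infinity_eq)
    with inf dfc show ?thesis
      by (simp add: ind_on_eq)
  qed
next
  case False
  then obtain a a' d d' where e: "nul V S = enat a" "nul W R = enat a'" "dfc V S = enat d" "dfc W R = enat d'"
    using nul dfc by (metis not_infinity_eq)
  with eq have "real a + real d' = real a' + real d"
    by (metis enat.inject of_nat_add plus_enat_simps(1))
  with e show ?thesis
    by (simp add: ind_on_eq)
qed

text \<open>Finite nullity or defect passes to the next range, and \<open>index_range_step\<close>
  gives the converse implications because one of the two is finite. This makes the index independent
  of the chosen power.\<close>

lemma ind_on_range_funpow: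
  assumes S: "clinear S" and fin: "nul (range (S ^^ a)) S \<noteq> \<infinity> \<or> dfc (range (S ^^ a)) S \<noteq> \<infinity>"
    and ak: "a \<le> k"
  shows "(nul (range (S ^^ k)) S = \<infinity> \<longleftrightarrow> nul (range (S ^^ a)) S = \<infinity>)
    \<and> (dfc (range (S ^^ k)) S = \<infinity> \<longleftrightarrow> dfc (range (S ^^ a)) S = \<infinity>)
    \<and> ind_on (range (S ^^ k)) S = ind_on (range (S ^^ a)) S"
  using ak
proof (induction k rule: dec_induct)
  case (step k)
  let ?V = "range (S ^^ k)" and ?W = "range (S ^^ Suc k)"
  have V: "csubspace ?V"
    using S by (rule csubspace_range_funpow)
  have sub: "?W \<subseteq> ?V"
    by (rule range_funpow_mono) simp
  have im: "S ` ?V = ?W"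
    by (rule image_range_funpow)
  have eq: "nul ?V S + dfc ?W S = nul ?W S + dfc ?V S"
    using index_range_step[OF S V] sub unfolding nul_def dfc_def im by simp
  have "nul ?V S \<noteq> \<infinity> \<Longrightarrow> nul ?W S \<noteq> \<infinity>"
    using fin_cdim_subset[of "{x \<in> ?V. S x = 0}" "{x \<in> ?W. S x = 0}"] sub
    by (auto simp: nul_infinite simp del: not_infinity_eq)
  moreover have "dfc ?V S \<noteq> \<infinity> \<Longrightarrow> dfc ?W S \<noteq> \<infinity>"
    using fin_mod_image[OF S, of ?V ?W] by (simp add: dfc_infinite image_range_funpow del: not_infinity_eq funpow.simps)
  moreover have "nul ?V S \<noteq> \<infinity> \<or> dfc ?V S \<noteq> \<infinity>"
    using fin step.IH by (simp del: not_infinity_eq)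
  ultimately have "(nul ?V S = \<infinity> \<longleftrightarrow> nul ?W S = \<infinity>) \<and> (dfc ?V S = \<infinity> \<longleftrightarrow> dfc ?W S = \<infinity>)"
    using eq by (cases "nul ?V S"; cases "dfc ?V S"; cases "nul ?W S"; cases "dfc ?W S"; simp)
  moreover from this have "ind_on ?V S = ind_on ?W S"
    using eq \<open>nul ?V S \<noteq> \<infinity> \<or> dfc ?V S \<noteq> \<infinity>\<close> by (intro ind_on_cong) auto
  ultimately show ?case
    using step.IH by simp
qed simp

text \<open>The assumptions are stable under replacing T, F by T + F, -F (see \<open>swap\<close>),
  so every fact can be used with the two operators exchanged by a second interpretation.\<close>

locale commuting_perturbation =
  fixes T F :: "'a::complex_banach \<Rightarrow> 'a" and n :: nat
  assumes T: "bop T" and F: "bop F"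
    and comm: "T (F x) = F (T x)"
    and fin: "fin_cdim (range (F ^^ n))"
begin

definition G where "G = (\<lambda>z. T z + F z)"

lemma G: "bop G"
  unfolding G_def using T F by (rule bop_add)

lemma lin [intro, simp]: "clinear T" "clinear F" "clinear G"
  using T F G by (simp_all add: bop_clinear)

lemma linear_simps:
  "T (x + y) = T x + T y" "F (x + y) = F x + F y" "G (x + y) = G x + G y"
  using lin by (simp_all add: clinear_iff)

lemma commG: "G (T x) = T (G x)" "G (F x) = F (G x)"
  by (simp_all add: G_def linear_simps comm)

lemma zero_simps: "T 0 = 0" "F 0 = 0" "G 0 = 0" "(T ^^ k) 0 = 0" "(F ^^ k) 0 = 0"
  using cvp.linear_0 lin clinear_funpow by blast+

lemma neg_simps: "T (- x) = - T x" "F (- x) = - F x"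
  using cvp.linear_neg lin by blast+

definition invariant :: "'a set \<Rightarrow> bool" where
  "invariant V \<longleftrightarrow> csubspace V \<and> T ` V \<subseteq> V \<and> F ` V \<subseteq> V"

text \<open>Stands in for membership in the algebra generated by T and F. Instead of polynomial
  expressions it records the properties that are used: boundedness, commutation with both
  generators, and preservation of every subspace invariant under both.\<close>

definition in_algebra :: "('a \<Rightarrow> 'a) \<Rightarrow> bool" where
  "in_algebra A \<longleftrightarrow> bop A \<and> (\<forall>x. A (T x) = T (A x)) \<and> (\<forall>x. A (F x) = F (A x))
    \<and> (\<forall>V. invariant V \<longrightarrow> A ` V \<subseteq> V)"

lemma in_algebra_T: "in_algebra T" and in_algebra_F: "in_algebra F"
  using T F by (simp_all add: in_algebra_def invariant_def comm)

lemma in_algebra_zero: "in_algebra (\<lambda>x. 0)"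
  by (auto simp: in_algebra_def invariant_def bop_zero zero_simps cvs.subspace_0)

lemma in_algebra_id: "in_algebra (\<lambda>x. x)"
  by (auto simp: in_algebra_def bop_id)

lemma in_algebra_add: "in_algebra A \<Longrightarrow> in_algebra B \<Longrightarrow> in_algebra (\<lambda>x. A x + B x)"
  by (auto simp: in_algebra_def bop_add linear_simps invariant_def image_subset_iff cvs.subspace_add)

lemma in_algebra_comp: "in_algebra A \<Longrightarrow> in_algebra B \<Longrightarrow> in_algebra (\<lambda>x. A (B x))"
  by (auto simp: in_algebra_def bop_comp image_subset_iff)

lemma in_algebra_G: "in_algebra G"
  unfolding G_def by (intro in_algebra_add in_algebra_T in_algebra_F)

lemma in_algebra_funpow: "in_algebra A \<Longrightarrow> in_algebra (A ^^ k)"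
proof (induction k)
  case 0
  then show ?case
    using in_algebra_id by (simp add: id_def)
next
  case (Suc k)
  then show ?case
    using in_algebra_comp[of A "A ^^ k"] by (simp add: comp_def)
qed

text \<open>Every monomial of degree j + m in the commuting operators T and F contains T^j or F^m.
  Induction on the degree replaces the binomial formula.\<close>

lemma funpow_add_decomposition:
  "\<exists>A B. in_algebra A \<and> in_algebra B \<and> (\<forall>x. (G ^^ (j + m)) x = (T ^^ j) (A x) + (F ^^ m) (B x))"
proof (induction "j + m" arbitrary: j m)
  case 0
  then show ?case
    by (intro exI[of _ "\<lambda>x. x"] exI[of _ "\<lambda>x. 0"])
      (simp add: in_algebra_id in_algebra_zero)
next
  case (Suc p)
  consider "j = 0" | "m = 0" | j' m' where "j = Suc j'" "m = Suc m'"
    using Suc.hyps by (cases j; cases m) auto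
  then show ?case
  proof cases
    case 1
    then show ?thesis
      by (intro exI[of _ "G ^^ m"] exI[of _ "\<lambda>x. 0"])
        (simp add: in_algebra_funpow in_algebra_G in_algebra_zero zero_simps)
  next
    case 2
    then show ?thesis
      by (intro exI[of _ "\<lambda>x. 0"] exI[of _ "G ^^ j"])
        (simp add: in_algebra_funpow in_algebra_G in_algebra_zero zero_simps)
  next
    case 3
    \<comment> \<open>Write G^(j+m) as T G^(j+m-1) + F G^(j+m-1). In the first summand the remaining
      exponent is split as (j-1) + m, in the second as j + (m-1), so T and F restore the missing
      factors.\<close>
    obtain A B where AB: "in_algebra A" "in_algebra B"
      "\<And>x. (G ^^ (j' + m)) x = (T ^^ j') (A x) + (F ^^ m) (B x)"
      using Suc.hyps(1)[of j' m] Suc.hyps(2) 3 by auto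
    obtain A' B' where AB': "in_algebra A'" "in_algebra B'"
      "\<And>x. (G ^^ (j + m')) x = (T ^^ j) (A' x) + (F ^^ m') (B' x)"
      using Suc.hyps(1)[of j m'] Suc.hyps(2) 3 by auto
    have FT: "F ((T ^^ i) x) = (T ^^ i) (F x)" "T ((F ^^ i) x) = (F ^^ i) (T x)" for i x
      by (simp_all add: funpow_commute comm)
    have lin_pow: "(T ^^ i) (x + y) = (T ^^ i) x + (T ^^ i) y" "(F ^^ i) (x + y) = (F ^^ i) x + (F ^^ i) y" for i x y
      using clinear_funpow[OF lin(1)] clinear_funpow[OF lin(2)] by (simp_all add: clinear_iff)
    have "(G ^^ (j + m)) x = (T ^^ j) (A x + F (A' x)) + (F ^^ m) (T (B x) + B' x)" for x
    proof -
      have "(G ^^ (j + m)) x = T ((G ^^ (j' + m)) x) + F ((G ^^ (j + m')) x)"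
        using 3 by (simp add: G_def)
      also have "\<dots> = T ((T ^^ j') (A x)) + T ((F ^^ m) (B x)) + (F ((T ^^ j) (A' x)) + F ((F ^^ m') (B' x)))"
        by (simp only: AB(3) AB'(3) linear_simps)
      also have "\<dots> = (T ^^ j) (A x) + (F ^^ m) (T (B x)) + ((T ^^ j) (F (A' x)) + (F ^^ m) (B' x))"
        by (simp only: FT) (simp add: 3)
      finally show ?thesis
        by (simp only: lin_pow) (simp add: ac_simps)
    qed
    then show ?thesis
      using AB AB' in_algebra_T in_algebra_F
      by (intro exI[of _ "\<lambda>x. A x + F (A' x)"] exI[of _ "\<lambda>x. T (B x) + B' x"])
        (simp add: in_algebra_add in_algebra_comp)
  qed
qed

lemma range_G_funpow: "range (G ^^ (k + n)) \<subseteq> cspan (range (T ^^ k) \<union> range (F ^^ n))"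
proof clarify
  fix x
  obtain A B where "\<And>x. (G ^^ (k + n)) x = (T ^^ k) (A x) + (F ^^ n) (B x)"
    using funpow_add_decomposition[of k n] by auto
  then show "(G ^^ (k + n)) x \<in> cspan (range (T ^^ k) \<union> range (F ^^ n))"
    by (intro cspan_UnI[of "(T ^^ k) (A x)"]) auto
qed

lemma swap: "commuting_perturbation G (\<lambda>z. - F z) n"
proof
  \<comment> \<open>Iterates of -F and F agree up to sign, so their ranges and kernels
    coincide.\<close>
  have pow: "((\<lambda>z. - F z) ^^ i) x = (F ^^ i) x \<or> ((\<lambda>z. - F z) ^^ i) x = - (F ^^ i) x" for i x
    by (induction i) (auto simp: neg_simps)
  have "((\<lambda>z. - F z) ^^ n) x \<in> range (F ^^ n)" for x
    using pow[of n x] cvs.subspace_neg[OF csubspace_range_funpow[OF lin(2), of n], of "(F ^^ n) x"]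
    by (elim disjE) simp_all
  then have "range ((\<lambda>z. - F z) ^^ n) \<subseteq> range (F ^^ n)"
    by (rule image_subsetI)
  then show "fin_cdim (range ((\<lambda>z. - F z) ^^ n))"
    by (rule fin_cdim_subset[OF fin])
  show "G (- F x) = - F (G x)" for x
    by (simp add: G_def linear_simps neg_simps comm)
qed (simp_all add: bop_uminus F G)

lemma swap_G: "commuting_perturbation.G G (\<lambda>z. - F z) = T"
  by (simp add: commuting_perturbation.G_def[OF swap]) (simp add: G_def)

lemma invariant_csubspace: "invariant V \<Longrightarrow> csubspace V"
  by (simp add: invariant_def)

lemma invariant_T: "invariant V \<Longrightarrow> T ` V \<subseteq> V" and invariant_F: "invariant V \<Longrightarrow> F ` V \<subseteq> V"
  by (simp_all add: invariant_def)

lemma invariant_G: "invariant V \<Longrightarrow> G ` V \<subseteq> V"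
  using in_algebra_G by (simp add: in_algebra_def)

lemma invariant_swap: "invariant V \<Longrightarrow> commuting_perturbation.invariant G (\<lambda>z. - F z) V"
  unfolding commuting_perturbation.invariant_def[OF swap] using invariant_G[of V]
  by (auto simp: invariant_def cvs.subspace_neg)

lemma invariant_image: "invariant V \<Longrightarrow> in_algebra A \<Longrightarrow> invariant (A ` V)"
proof -
  assume V: "invariant V" and A: "in_algebra A"
  have "T ` A ` V = A ` T ` V" "F ` A ` V = A ` F ` V"
    using A by (simp_all add: in_algebra_def image_image)
  then show "invariant (A ` V)"
    using V A by (simp add: invariant_def in_algebra_def csubspace_image bop_clinear image_mono)
qed

lemma invariant_range: "in_algebra A \<Longrightarrow> invariant (range A)"
  by (rule invariant_image) (simp_all add: invariant_def)

lemma fin_mod_range_G: "fin_mod (range (G ^^ (k + n))) (range (T ^^ k))"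
  by (rule fin_mod_mono[OF fin_mod_Un_fin_cdim[OF fin] range_G_funpow order_refl])

lemma fin_mod_range_T: "fin_mod (range (T ^^ (k + n))) (range (G ^^ k))"
  using commuting_perturbation.fin_mod_range_G[OF swap] by (simp only: swap_G)

text \<open>The exchanged decomposition, restated without the second locale. The remainder is (-F)^n
  followed by or preceded by an operator commuting with F, so it has finite rank and vanishes on
  N(F^n).\<close>

lemma T_funpow_decomposition:
  assumes "invariant V"
  obtains A B where "bop A" "bop B" "\<And>x. A (G x) = G (A x)" "A ` V \<subseteq> V"
    "\<And>x. (T ^^ (k + n)) x = (G ^^ k) (A x) + B x" "fin_cdim (range B)" "\<And>x. (F ^^ n) x = 0 \<Longrightarrow> B x = 0"
proof -
  let ?F = "\<lambda>z. - F z"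
  interpret sw: commuting_perturbation G ?F n
    by (rule swap)
  obtain A B where A: "sw.in_algebra A" and B: "sw.in_algebra B"
    and eq: "\<And>x. (T ^^ (k + n)) x = (G ^^ k) (A x) + (?F ^^ n) (B x)"
    using sw.funpow_add_decomposition[of k n] unfolding swap_G by metis
  have pow: "(?F ^^ i) x = (F ^^ i) x \<or> (?F ^^ i) x = - (F ^^ i) x" for i x
    by (induction i) (auto simp: neg_simps)
  have com: "(?F ^^ n) (B x) = B ((?F ^^ n) x)" for x
    using B funpow_commute[of ?F B] by (simp add: sw.in_algebra_def)
  show ?thesis
  proof (rule that)
    show "bop A" "\<And>x. A (G x) = G (A x)" "A ` V \<subseteq> V"
      using A invariant_swap[OF assms] by (simp_all add: sw.in_algebra_def)
    show "bop (\<lambda>x. (?F ^^ n) (B x))"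
      using B sw.F by (intro bop_comp[of "?F ^^ n" B] bop_funpow) (simp_all add: sw.in_algebra_def)
    show "fin_cdim (range (\<lambda>x. (?F ^^ n) (B x)))"
      using sw.fin by (rule fin_cdim_subset) auto
    show "(?F ^^ n) (B x) = 0" if "(F ^^ n) x = 0" for x
    proof -
      have "(?F ^^ n) x = 0"
        using pow[of n x] that by auto
      then show ?thesis
        using B by (simp add: com sw.in_algebra_def bop_clinear cvp.linear_0)
    qed
  qed (rule eq)
qed

text \<open>On N(G) the operator T^(1+n) equals the finite-rank remainder, since A commutes with G.
  Hence N(G) \<inter> V is finite modulo N(T^(1+n)) \<inter> V, which has finite dimension.\<close>

lemma fin_cdim_kernel_G:
  assumes V: "invariant V" and ker: "fin_cdim {x \<in> V. T x = 0}"
  shows "fin_cdim {x \<in> V. G x = 0}"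
proof -
  let ?N = "{x \<in> V. G x = 0}"
  obtain A B where A: "\<And>x. A (G x) = G (A x)" "bop A" and B: "fin_cdim (range B)"
    and AB: "\<And>x. (T ^^ (1 + n)) x = (G ^^ 1) (A x) + B x"
    using T_funpow_decomposition[OF V, of 1] by metis
  have "(T ^^ (1 + n)) ` ?N \<subseteq> range B"
  proof clarify
    fix x assume "G x = 0"
    then have "G (A x) = 0"
      using A(1)[of x] A(2) by (simp add: cvp.linear_0 bop_clinear)
    then show "(T ^^ (1 + n)) x \<in> range B"
      by (simp only: AB) simp
  qed
  then have "fin_mod ((T ^^ (1 + n)) ` ?N) {0}"
    using fin_cdim_subset[OF B] by (simp only: fin_mod_zero)
  then have "fin_mod ?N {x \<in> ?N. (T ^^ (1 + n)) x \<in> {0}}"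
    using V by (intro fin_mod_vimage csubspace_kernel clinear_funpow cvs.subspace_single_0 lin invariant_csubspace)
  moreover have "fin_cdim {x \<in> ?N. (T ^^ (1 + n)) x \<in> {0}}"
    using fin_cdim_kernel_funpow[OF lin(1) invariant_csubspace[OF V] invariant_T[OF V] ker, of "1 + n"]
    by (rule fin_cdim_subset) auto
  ultimately show ?thesis
    by (rule fin_cdim_trans)
qed

text \<open>T^(1+n)(V) has finite codimension in V and lies in G(V) plus a finite-dimensional
  space.\<close>

lemma fin_mod_image_G:
  assumes V: "invariant V" and ran: "fin_mod V (T ` V)"
  shows "fin_mod V (G ` V)"
proof -
  obtain A B where A: "A ` V \<subseteq> V" and B: "fin_cdim (range B)"
    and AB: "\<And>x. (T ^^ (1 + n)) x = (G ^^ 1) (A x) + B x"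
    using T_funpow_decomposition[OF V, of 1] by metis
  have "(T ^^ (1 + n)) ` V \<subseteq> cspan (G ` V \<union> range B)"
  proof clarify
    fix x assume "x \<in> V"
    then show "(T ^^ (1 + n)) x \<in> cspan (G ` V \<union> range B)"
      using A by (simp only: AB) (intro cspan_UnI[of "G (A x)"], auto)
  qed
  then have "fin_mod ((T ^^ (1 + n)) ` V) (G ` V)"
    using fin_mod_mono[OF fin_mod_Un_fin_cdim[OF B]] by blast
  with fin_mod_funpow_image[OF lin(1) ran] show ?thesis
    using fin_mod_trans by blast
qed

text \<open>On the graded pieces \<open>V / F V\<close> of the filtration by the ranges of the powers of \<open>F\<close>,
  the operators \<open>T\<close> and \<open>T + F\<close> induce the same map.\<close>

lemma index_invariant_perturbation:
  assumes "invariant V" "fin_cdim {x \<in> V. T x = 0}" "fin_mod V (T ` V)" "fin_cdim ((F ^^ m) ` V)"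
  shows "nul V T + dfc V G = nul V G + dfc V T"
  using assms
proof (induction m arbitrary: V)
  case 0
  then have V: "csubspace V" "fin_mod V {0}" "T ` V \<subseteq> V" "G ` V \<subseteq> V"
    by (simp_all add: invariant_csubspace invariant_T invariant_G fin_mod_zero)
  \<comment> \<open>On a finite-dimensional space every endomorphism has index zero: compare V with
    the invariant subspace {0}.\<close>
  have "nul V S = dfc V S" if S: "clinear S" "S ` V \<subseteq> V" for S
  proof -
    have "S ` {0} = {0}" "{x \<in> {0}. S x = 0} = {0}"
      using S by (auto simp: cvp.linear_0)
    then have "nul V S + qdim {0} {0 :: 'a} = qdim {0} {0 :: 'a} + dfc V S"
      using index_invariant_fin_mod[of S V "{0}"] V S
      by (simp add: nul_def dfc_def cvs.subspace_0 cvs.subspace_single_0)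
    moreover have "qdim {0} {0 :: 'a} \<noteq> \<infinity>"
      unfolding qdim_infinite by (simp add: fin_mod_subset)
    ultimately show ?thesis
      by (simp only: add.commute[of "nul V S"] enat_add_left_cancel) simp
  qed
  then show ?case
    using V(3,4) by (simp add: add.commute)
next
  case (Suc m)
  let ?W = "F ` V"
  have W: "invariant ?W" "?W \<subseteq> V"
    using Suc.prems(1) by (simp_all add: invariant_image in_algebra_F invariant_F)
  have "fin_cdim {x \<in> ?W. T x = 0}"
    using Suc.prems(2) by (rule fin_cdim_subset) (use W in auto)
  moreover have "fin_mod ?W (T ` ?W)"
  proof -
    have "T ` ?W = F ` T ` V"
      by (simp add: image_image comm)
    then show ?thesis
      using fin_mod_image[OF lin(2) Suc.prems(3)] by simp
  qed
  moreover have "fin_cdim ((F ^^ m) ` ?W)"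
    using Suc.prems(4) by (simp only: funpow_Suc_right image_comp)
  ultimately have IH: "nul ?W T + dfc ?W G = nul ?W G + dfc ?W T"
     and fin_W: "fin_cdim {x \<in> ?W. T x = 0}" "fin_mod ?W (T ` ?W)"
    using Suc.IH W by blast+
  have fin_WG: "fin_cdim {x \<in> ?W. G x = 0}" "fin_mod ?W (G ` ?W)"
    and fin_VG: "fin_cdim {x \<in> V. G x = 0}" "fin_mod V (G ` V)"
    using fin_W Suc.prems W fin_cdim_kernel_G fin_mod_image_G by blast+
  \<comment> \<open>Defect and nullity of the common induced map on V/F(V). Both are finite, so they
    cancel between the two snake identities.\<close>
  define c k where "c = qdim V (cspan (?W \<union> T ` V))" and "k = qdim {x \<in> V. T x \<in> ?W} ?W"
  have "cspan (?W \<union> T ` V) = cspan (?W \<union> G ` V)"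
  proof (rule antisym; rule cvs.span_minimal[OF _ cvs.subspace_span])
    have "T x \<in> cspan (?W \<union> G ` V)" "G x \<in> cspan (?W \<union> T ` V)" if "x \<in> V" for x
      using that W(1) cspan_UnI[of "- F x" ?W "T x" "G ` V"] cspan_UnI[of "F x" ?W "G x" "T ` V"]
      by (simp_all add: G_def invariant_csubspace cvs.subspace_neg)
    then show "?W \<union> T ` V \<subseteq> cspan (?W \<union> G ` V)" "?W \<union> G ` V \<subseteq> cspan (?W \<union> T ` V)"
      by (auto intro: cvs.span_base)
  qed
  moreover have "{x \<in> V. T x \<in> ?W} = {x \<in> V. G x \<in> ?W}"
  proof -
    have "T x \<in> ?W \<longleftrightarrow> T x + F x \<in> ?W" if "x \<in> V" for x
      using cvs.subspace_add[of ?W "T x" "F x"] cvs.subspace_diff[of ?W "T x + F x" "F x"] that W(1)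
      by (auto simp: invariant_csubspace)
    then show ?thesis
      by (auto simp: G_def)
  qed
  ultimately have sn: "nul V T + dfc ?W T + c = nul ?W T + dfc V T + k"
    "nul V G + dfc ?W G + c = nul ?W G + dfc V G + k"
    using index_snake[of T V ?W] index_snake[of G V ?W] Suc.prems(1) W
    unfolding nul_def dfc_def c_def k_def
    by (simp_all add: invariant_csubspace invariant_T invariant_G)
  have "c \<noteq> \<infinity>"
    unfolding c_def qdim_infinite using Suc.prems(3) cvs.span_superset[of "?W \<union> T ` V"]
    by (auto intro: fin_mod_mono)
  moreover have "nul V T \<noteq> \<infinity>" "nul V G \<noteq> \<infinity>" "nul ?W T \<noteq> \<infinity>" "nul ?W G \<noteq> \<infinity>"
    "dfc V T \<noteq> \<infinity>" "dfc V G \<noteq> \<infinity>" "dfc ?W T \<noteq> \<infinity>" "dfc ?W G \<noteq> \<infinity>"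
    using fin_W fin_WG fin_VG Suc.prems by (simp_all add: nul_infinite dfc_infinite del: not_infinity_eq)
  moreover from sn(1) have "k \<noteq> \<infinity>"
    using calculation by (metis plus_eq_infty_iff_enat)
  ultimately obtain c' k' v1 v2 w1 w2 v3 v4 w3 w4 where "c = enat c'" "k = enat k'"
    "nul V T = enat v1" "nul V G = enat v2" "nul ?W T = enat w1" "nul ?W G = enat w2"
    "dfc V T = enat v3" "dfc V G = enat v4" "dfc ?W T = enat w3" "dfc ?W G = enat w4"
    by (metis not_infinity_eq)
  then show ?case
    using sn IH by simp
qed

section \<open>Comparison of T and G on the ranges of their powers\<close>

lemma invariant_range_T: "invariant (range (T ^^ k))" and invariant_range_G: "invariant (range (G ^^ k))"
  by (intro invariant_range in_algebra_funpow in_algebra_T in_algebra_G)+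

lemma fin_mod_ranges:
  assumes "fin_mod (range (T ^^ k)) (T ` range (T ^^ k))"
  shows "fin_mod (range (T ^^ k)) (range (T ^^ j))" "fin_mod (range (T ^^ k)) (range (G ^^ j))"
proof -
  have "fin_mod (range (T ^^ k)) ((T ^^ i) ` range (T ^^ k))" for i
    using assms by (intro fin_mod_funpow_image lin)
  then show *: "fin_mod (range (T ^^ k)) (range (T ^^ j))" for j
    using range_funpow_mono[of j "j + k" T]
      fin_mod_mono[of "range (T ^^ k)" "range (T ^^ (j + k))" "range (T ^^ k)" "range (T ^^ j)"]
    by (simp add: funpow_image_range)
  from *[of "j + n"] show "fin_mod (range (T ^^ k)) (range (G ^^ j))"
    using fin_mod_range_T by (rule fin_mod_trans)
qed

lemma fin_mod_range_G_step:
  assumes "fin_mod (range (T ^^ k)) (T ` range (T ^^ k))"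
  shows "fin_mod (range (G ^^ (k + n))) (G ` range (G ^^ (k + n)))"
  unfolding image_range_funpow
  by (rule fin_mod_trans[OF fin_mod_range_G fin_mod_ranges(2)[OF assms]])

text \<open>R(G^(k+n)) lies in R(T^k) up to finitely many dimensions. This is applied with N = N(G)
  for the nullity of G and with N = N(T^k) for Neubauer's lemma.\<close>

lemma fin_cdim_Int_range_G:
  assumes "csubspace N" "fin_cdim (range (T ^^ k) \<inter> N)"
  shows "fin_cdim (range (G ^^ (k + n)) \<inter> N)"
  by (rule fin_cdim_trans[OF fin_mod_Int assms(2)])
    (simp_all add: assms(1) csubspace_range_funpow fin_mod_range_G del: funpow.simps)

lemma fin_cdim_kernel_range_G:
  assumes "fin_cdim {x \<in> range (T ^^ k). T x = 0}"
  shows "fin_cdim {x \<in> range (G ^^ (k + n)). G x = 0}"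
proof -
  have "fin_cdim {x \<in> range (T ^^ k). G x = 0}"
    using invariant_range_T assms by (rule fin_cdim_kernel_G)
  then have "fin_cdim (range (T ^^ k) \<inter> {x. G x = 0})"
    by (rule fin_cdim_subset) auto
  then have "fin_cdim (range (G ^^ (k + n)) \<inter> {x. G x = 0})"
    using csubspace_kernel[OF lin(3) csubspace_UNIV] by (intro fin_cdim_Int_range_G) auto
  then show ?thesis
    by (rule fin_cdim_subset) auto
qed

text \<open>The case of finite nullity and defect, in three moves: from T to G on V = R(T^k), then
  from V up to U = V + W, then down to W = R(G^(k+n)). The sum U is needed because V and W need not
  be nested.\<close>

lemma ind_on_range_G:
  assumes fin: "fin_cdim {x \<in> range (T ^^ k). T x = 0}" "fin_mod (range (T ^^ k)) (T ` range (T ^^ k))"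
  shows "ind_on (range (G ^^ (k + n))) G = ind_on (range (T ^^ k)) T"
proof -
  define V W U where "V = range (T ^^ k)" and "W = range (G ^^ (k + n))" and "U = cspan (V \<union> W)"
  have V: "csubspace V" "G ` V \<subseteq> V" and W: "csubspace W" "G ` W \<subseteq> W"
    using invariant_range_T[of k] invariant_range_G[of "k + n"]
    by (simp_all only: V_def W_def invariant_csubspace invariant_G)
  have U: "csubspace U" "V \<subseteq> U" "W \<subseteq> U"
    using cvs.span_superset[of "V \<union> W"] by (auto simp: U_def)
  have "G ` U = cspan (G ` (V \<union> W))"
    by (simp only: U_def cvp.linear_span_image[OF lin(3)])
  also have "\<dots> \<subseteq> U"
    unfolding U_def using V(2) W(2) by (intro cvs.span_mono) auto
  finally have GU: "G ` U \<subseteq> U" .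
  have "fin_mod W V" "fin_mod V W"
    using fin_mod_range_G fin_mod_ranges(2)[OF fin(2)] by (simp_all only: V_def W_def)
  then have UV: "fin_mod U V" and UW: "fin_mod U W"
    unfolding U_def by (simp_all add: fin_mod_Un fin_mod_subset)
  have VT: "nul V T + dfc V G = nul V G + dfc V T"
    unfolding V_def
  proof (rule index_invariant_perturbation[OF invariant_range_T fin])
    show "fin_cdim ((F ^^ n) ` range (T ^^ k))"
      using commuting_perturbation.fin[OF commuting_perturbation_axioms] by (rule fin_cdim_subset) auto
  qed
  have GV: "nul U G + dfc V G = nul V G + dfc U G"
    unfolding nul_def dfc_def by (rule index_invariant_fin_mod[OF lin(3) U(1) V(1) U(2) GU V(2) UV])
  have GW: "nul U G + dfc W G = nul W G + dfc U G"
    unfolding nul_def dfc_def by (rule index_invariant_fin_mod[OF lin(3) U(1) W(1) U(3) GU W(2) UW])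
  have T_fin: "nul V T \<noteq> \<infinity>" "dfc V T \<noteq> \<infinity>"
    using fin by (simp_all only: nul_infinite dfc_infinite V_def not_not)
  have W_fin: "nul W G \<noteq> \<infinity>" "dfc W G \<noteq> \<infinity>"
    using fin_cdim_kernel_range_G[OF fin(1)] fin_mod_range_G_step[OF fin(2)]
    by (simp_all only: nul_infinite dfc_infinite W_def not_not)
  have V_fin: "nul V G \<noteq> \<infinity>" "dfc V G \<noteq> \<infinity>"
    using fin_cdim_kernel_G[OF invariant_range_T fin(1)] fin_mod_image_G[OF invariant_range_T fin(2)]
    by (simp_all only: nul_infinite dfc_infinite V_def not_not)
  have "fin_cdim ({x \<in> U. G x = 0})"
  proof -
    have "fin_mod (U \<inter> {x. G x = 0}) (V \<inter> {x. G x = 0})"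
      using csubspace_kernel[OF lin(3) csubspace_UNIV] U V UV by (intro fin_mod_Int) auto
    moreover have "fin_cdim (V \<inter> {x. G x = 0})"
      using fin_cdim_kernel_G[OF invariant_range_T fin(1)] by (rule fin_cdim_subset) (auto simp: V_def)
    ultimately have "fin_cdim (U \<inter> {x. G x = 0})"
      by (rule fin_cdim_trans)
    then show ?thesis
      by (rule fin_cdim_subset) auto
  qed
  then have U_fin: "nul U G \<noteq> \<infinity>"
    by (simp only: nul_infinite not_not)
  have U_fin': "dfc U G \<noteq> \<infinity>"
    using GV U_fin V_fin by (metis plus_eq_infty_iff_enat)
  obtain a1 a2 a3 a4 b1 b2 b3 b4 where "nul V T = enat a1" "dfc V T = enat b1" "nul W G = enat a2"
    "dfc W G = enat b2" "nul V G = enat a3" "dfc V G = enat b3" "nul U G = enat a4" "dfc U G = enat b4"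
    using T_fin W_fin V_fin U_fin U_fin' by (metis not_infinity_eq)
  then have "ind_on W G = ind_on V T"
    using VT GV GW by (intro ind_on_cong) simp_all
  then show ?thesis
    by (simp only: V_def W_def)
qed

lemma nul_range_G: "nul (range (T ^^ k)) T \<noteq> \<infinity> \<Longrightarrow> nul (range (G ^^ (k + n))) G \<noteq> \<infinity>"
  using fin_cdim_kernel_range_G by (simp only: nul_infinite not_not)

lemma dfc_range_G: "dfc (range (T ^^ k)) T \<noteq> \<infinity> \<Longrightarrow> dfc (range (G ^^ (k + n))) G \<noteq> \<infinity>"
  using fin_mod_range_G_step by (simp only: dfc_infinite not_not)

text \<open>Stability moves both indices to one large power, where finiteness of nullity and of
  defect transfers between T and G in both directions.\<close>

lemma ind_on_range_perturbation:
  assumes T_fin: "nul (range (T ^^ a)) T \<noteq> \<infinity> \<or> dfc (range (T ^^ a)) T \<noteq> \<infinity>"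
    and G_fin: "nul (range (G ^^ b)) G \<noteq> \<infinity> \<or> dfc (range (G ^^ b)) G \<noteq> \<infinity>"
  shows "ind_on (range (G ^^ b)) G = ind_on (range (T ^^ a)) T"
proof -
  interpret sw: commuting_perturbation G "\<lambda>z. - F z" n
    by (rule swap)
  define K where "K = a + b"
  note T_stable = ind_on_range_funpow[OF lin(1) T_fin]
  note G_stable = ind_on_range_funpow[OF lin(3) G_fin]
  have ge: "a \<le> K" "b \<le> K" "b \<le> K + n" "a \<le> K + n"
    by (simp_all add: K_def)
  have nul: "nul (range (T ^^ K)) T = \<infinity> \<longleftrightarrow> nul (range (G ^^ (K + n))) G = \<infinity>"
    using nul_range_G[of K] sw.nul_range_G[of "K"] T_stable[OF ge(1)] T_stable[OF ge(4)]
      G_stable[OF ge(2)] G_stable[OF ge(3)]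
    unfolding swap_G by (auto simp del: not_infinity_eq)
  have dfc: "dfc (range (T ^^ K)) T = \<infinity> \<longleftrightarrow> dfc (range (G ^^ (K + n))) G = \<infinity>"
    using dfc_range_G[of K] sw.dfc_range_G[of "K"] T_stable[OF ge(1)] T_stable[OF ge(4)]
      G_stable[OF ge(2)] G_stable[OF ge(3)]
    unfolding swap_G by (auto simp del: not_infinity_eq)
  have fin: "nul (range (T ^^ K)) T \<noteq> \<infinity> \<or> dfc (range (T ^^ K)) T \<noteq> \<infinity>"
    using T_fin T_stable[OF ge(1)] by (simp del: not_infinity_eq)
  have "ind_on (range (G ^^ (K + n))) G = ind_on (range (T ^^ K)) T"
  proof (cases "nul (range (T ^^ K)) T \<noteq> \<infinity> \<and> dfc (range (T ^^ K)) T \<noteq> \<infinity>")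
    case True
    then show ?thesis
      by (intro ind_on_range_G) (simp_all only: nul_infinite dfc_infinite not_not)
  next
    case False
    \<comment> \<open>With an infinite term for both operators, the sum identity required by
      \<open>ind_on_cong\<close> reads infinity = infinity.\<close>
    then have "nul (range (G ^^ (K + n))) G + dfc (range (T ^^ K)) T = \<infinity>"
      "nul (range (T ^^ K)) T + dfc (range (G ^^ (K + n))) G = \<infinity>"
      using nul dfc by (auto simp only: plus_eq_infty_iff_enat)
    then show ?thesis
      using nul dfc fin by (intro ind_on_cong) auto
  qed
  then show ?thesis
    using T_stable[OF ge(1)] G_stable[OF ge(3)] by simp
qed

end

section \<open>Closed ranges\<close>

lemma csubspace_imp_subspace: "csubspace V \<Longrightarrow> subspace V"
  by (simp add: cvs.subspace_def subspace_def scaleC_of_real[symmetric])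

lemma tendsto_scaleC_left:
  assumes "(c \<longlongrightarrow> l) M"
  shows "((\<lambda>n. scaleC (c n) x) \<longlongrightarrow> scaleC l x) M"
proof -
  have "((\<lambda>n. cmod (c n - l) * norm x) \<longlongrightarrow> 0) M"
    using assms by (simp add: tendsto_mult_left_zero tendsto_norm_zero LIM_zero)
  then have "((\<lambda>n. norm (scaleC (c n) x - scaleC l x)) \<longlongrightarrow> 0) M"
    by (simp add: cvs.scale_left_diff_distrib[symmetric] norm_scaleC)
  then show ?thesis
    by (simp add: tendsto_norm_zero_iff LIM_zero_iff)
qed

text \<open>If v lies outside V, its distance d to V is positive, and cmod c * d \<le> norm (s + c
  v) for s in V. Hence the coefficients of v along a convergent sequence are Cauchy.\<close>

lemma closed_cspan_insert:
  assumes V: "csubspace V" "closed V"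
  shows "closed (cspan (insert v V))"
proof (cases "v \<in> V")
  case True
  then show ?thesis
    using V by (simp add: insert_absorb cvs.span_eq_iff[THEN iffD2])
next
  case False
  have mem: "x \<in> cspan (insert v V) \<longleftrightarrow> (\<exists>k. x - scaleC k v \<in> V)" for x
    using V by (simp add: cvs.span_insert cvs.span_eq_iff[THEN iffD2])
  define d where "d = infdist v V"
  have "V \<noteq> {}"
    using V cvs.subspace_0 by auto
  then have d: "d > 0"
    using V(2) False by (simp add: d_def infdist_pos_not_in_closed)
  have bound: "cmod c * d \<le> norm (s + scaleC c v)" if s: "s \<in> V" for c s
  proof (cases "c = 0")
    case False
    have "d \<le> dist v (scaleC (- inverse c) s)"
      unfolding d_def using s V by (intro infdist_le cvs.subspace_scale)
    also have "\<dots> = norm (v + scaleC (inverse c) s)"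
      by (simp add: dist_norm cvs.scale_minus_left)
    finally have "cmod c * d \<le> norm (scaleC c (v + scaleC (inverse c) s))"
      by (simp add: norm_scaleC mult_left_mono)
    then show ?thesis
      using False by (simp add: scaleC_add_right scaleC_scaleC scaleC_one add.commute)
  qed simp
  show ?thesis
    unfolding closed_sequential_limits
  proof (intro allI impI, elim conjE)
    fix y l assume y: "\<forall>n. y n \<in> cspan (insert v V)" and lim: "y \<longlonglongrightarrow> l"
    then have "\<forall>n. \<exists>k. y n - scaleC k v \<in> V"
      by (simp add: mem)
    then obtain c where c: "\<And>n. y n - scaleC (c n) v \<in> V"
      by metis
    have "Cauchy c"
    proof (rule metric_CauchyI)
      fix e :: real assume "e > 0"
      then obtain N where N: "\<And>m n. m \<ge> N \<Longrightarrow> n \<ge> N \<Longrightarrow> dist (y m) (y n) < e * d"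
        using metric_CauchyD[OF LIMSEQ_imp_Cauchy[OF lim], of "e * d"] d by auto
      have "dist (c m) (c n) < e" if "m \<ge> N" "n \<ge> N" for m n
      proof -
        have "(y m - scaleC (c m) v) - (y n - scaleC (c n) v) \<in> V"
          using c V(1) by (intro cvs.subspace_diff[OF V(1) c c])
        from bound[OF this, of "c m - c n"] have "cmod (c m - c n) * d \<le> dist (y m) (y n)"
          by (simp add: dist_norm cvs.scale_left_diff_distrib algebra_simps)
        also have "\<dots> < e * d"
          using N that by simp
        finally show ?thesis
          using d by (simp add: dist_norm)
      qed
      then show "\<exists>M. \<forall>m\<ge>M. \<forall>n\<ge>M. dist (c m) (c n) < e"
        by blast
    qed
    then obtain k where "c \<longlonglongrightarrow> k"
      using Cauchy_convergent convergent_def by blast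
    then have "(\<lambda>n. y n - scaleC (c n) v) \<longlonglongrightarrow> l - scaleC k v"
      using lim by (intro tendsto_diff tendsto_scaleC_left)
    then have "l - scaleC k v \<in> V"
      by (rule closed_sequentially[OF V(2) c])
    then show "l \<in> cspan (insert v V)"
      by (auto simp: mem)
  qed
qed

lemma closed_cspan_Un_finite:
  assumes V: "csubspace V" "closed V" and "finite S"
  shows "closed (cspan (V \<union> S))"
  using assms(3)
proof (induction S)
  case empty
  then show ?case
    using V by (simp add: cvs.span_eq_iff[THEN iffD2])
next
  case (insert v S)
  have "cspan (insert v (cspan (V \<union> S))) = cspan (V \<union> insert v S)"
    using cspan_Un_cspan[of "V \<union> S" "{v}"] by simp
  then show ?case
    using closed_cspan_insert[OF cvs.subspace_span insert.IH] by metis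
qed

text \<open>The finitely many vectors in \<open>fin_mod\<close> may lie outside U; a relative basis
  provides vectors of U that span it together with V.\<close>

lemma closed_fin_mod:
  assumes V: "csubspace V" "closed V" and U: "csubspace U" and VU: "V \<subseteq> U" and fin: "fin_mod U V"
  shows "closed U"
proof -
  obtain BV BU where B: "cvs.independent BU" "BV \<subseteq> BU" "cspan BV = V" "BU \<subseteq> U" "U \<subseteq> cspan BU"
    using relative_basis[OF V(1) VU] by metis
  have eq: "cspan BU = U"
    using B(4,5) cvs.span_minimal[OF B(4) U] by simp
  have "qdim U V < \<infinity>"
    using fin by (simp only: qdim_finite)
  then have "finite (BU - BV)"
    using qdim_basis[OF B(1,2)] unfolding B(3) eq by (simp split: if_splits)
  moreover have "cspan (V \<union> (BU - BV)) = U"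
    using cspan_Un_cspan[of BV "BU - BV"] B(2,3) eq by (simp add: Un_absorb1)
  ultimately show ?thesis
    using closed_cspan_Un_finite[OF V] by metis
qed

lemma closed_fin_cdim: "csubspace E \<Longrightarrow> fin_cdim E \<Longrightarrow> closed E"
  by (rule closed_fin_mod[of "{0}"]) (simp_all add: cvs.subspace_single_0 cvs.subspace_0 fin_mod_zero)

text \<open>The open mapping theorem for the restriction of \<open>f\<close> to \<open>V\<close>; the first half is Baire's
  theorem, the second the usual successive approximation.\<close>

lemma approximate_preimage:
  fixes f :: "'a::banach \<Rightarrow> 'b::banach"
  assumes f: "bounded_linear f" and V: "subspace V" and fV: "closed (f ` V)"
  obtains K where "K > 0"
    "\<And>y e. y \<in> f ` V \<Longrightarrow> e > 0 \<Longrightarrow> \<exists>x\<in>V. norm x \<le> K * norm y \<and> norm (y - f x) < e"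
proof -
  interpret f: bounded_linear f
    by (rule f)
  let ?W = "f ` V"
  define C where "C m = closure (f ` (V \<inter> cball 0 (real m)))" for m
  have CW: "C m \<subseteq> ?W" for m
    unfolding C_def using fV by (intro closure_minimal) auto
  have "x \<in> V \<Longrightarrow> f x \<in> C (nat \<lceil>norm x\<rceil>)" for x
    unfolding C_def by (intro closure_subset[THEN subsetD] imageI) (auto simp: of_nat_ceiling)
  then have "\<Union>(range C) = ?W"
    using CW by blast
  moreover have "0 \<in> ?W"
    using V by (intro image_eqI[of _ _ 0]) (simp_all add: f.zero subspace_0)
  ultimately have nonempty: "top_of_set ?W interior_of \<Union>(range C) \<noteq> {}"
    using interior_of_topspace[of "top_of_set ?W"] by auto
  have complete: "completely_metrizable_space (top_of_set ?W)"
    using fV by (simp add: completely_metrizable_space_closedin completely_metrizable_space_euclidean)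
  have closedin: "closedin (top_of_set ?W) (C m)" for m
    using CW[of m] by (simp add: C_def closed_subset)
  have "\<exists>m. top_of_set ?W interior_of (C m) \<noteq> {}"
  proof (rule ccontr)
    assume "\<not> ?thesis"
    then have "top_of_set ?W interior_of \<Union>(range C) = {}"
      using complete closedin by (intro Baire_category_alt) auto
    with nonempty show False
      by contradiction
  qed
  then obtain m y0 where y0_int: "y0 \<in> top_of_set ?W interior_of (C m)"
    by blast
  moreover have "openin (top_of_set ?W) (top_of_set ?W interior_of (C m))"
    by (rule openin_interior_of)
  ultimately obtain r where r: "r > 0" and y0: "y0 \<in> ?W"
    and int: "\<And>y. y \<in> ?W \<Longrightarrow> dist y y0 < r \<Longrightarrow> y \<in> top_of_set ?W interior_of (C m)"
    unfolding openin_euclidean_subtopology_iff by blast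
  have ball: "y \<in> C m" if "y \<in> ?W" "dist y y0 < r" for y
    using int[OF that] interior_of_subset[of "top_of_set ?W" "C m"] by blast
  \<comment> \<open>Subtracting approximate preimages of \<open>y0\<close> and \<open>y0 + y\<close>
    moves the ball to the origin and doubles the norm bound.\<close>
  have near: "\<exists>x\<in>V. norm x \<le> 2 * real m \<and> norm (y - f x) < e"
    if y: "y \<in> ?W" "norm y < r" and e: "e > 0" for y e
  proof -
    have "y0 + y \<in> C m" "y0 \<in> C m"
      using r y y0 subspace_add[OF linear_subspace_image[OF f.linear_axioms V]]
      by (auto simp: dist_norm intro!: ball)
    then have "\<exists>x. x \<in> V \<and> norm x \<le> real m \<and> dist (f x) z < e / 2" if "z = y0 + y \<or> z = y0" for z
      using that e half_gt_zero[OF e] unfolding C_def closure_approachable by fastforce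
    then obtain x1 x2 where x: "x1 \<in> V" "norm x1 \<le> real m" "dist (f x1) (y0 + y) < e / 2"
       "x2 \<in> V" "norm x2 \<le> real m" "dist (f x2) y0 < e / 2"
      by blast
    have "norm (y - f (x1 - x2)) = norm ((f x2 - y0) - (f x1 - (y0 + y)))"
      by (simp add: f.diff algebra_simps)
    also have "\<dots> < e"
      using norm_triangle_ineq4[of "f x2 - y0" "f x1 - (y0 + y)"] x by (simp add: dist_norm)
    finally show ?thesis
      using x V norm_triangle_ineq4[of x1 x2] by (intro bexI[of _ "x1 - x2"]) (auto simp: subspace_diff)
  qed
  \<comment> \<open>Rescaling \<open>y\<close> to norm r/2 turns the bound 2m into 4m/r times the
    norm of \<open>y\<close>; the summand 1 keeps \<open>K\<close> positive when m = 0.\<close>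
  define K where "K = 4 * real m / r + 1"
  show ?thesis
  proof (rule that)
    show "K > 0"
      using r by (simp add: K_def add_nonneg_pos)
    fix y and e :: real assume y: "y \<in> ?W" and e: "e > 0"
    show "\<exists>x\<in>V. norm x \<le> K * norm y \<and> norm (y - f x) < e"
    proof (cases "y = 0")
      case True
      then show ?thesis
        using e V by (intro bexI[of _ 0]) (auto simp: f.zero subspace_0)
    next
      case False
      define t where "t = r / (2 * norm y)"
      have t: "t > 0" "norm (t *\<^sub>R y) < r"
        using False r by (auto simp: t_def)
      have "t *\<^sub>R y \<in> ?W"
        using y V f.linear_axioms by (simp add: linear_subspace_image subspace_scale)
      from near[OF this t(2), of "t * e"] obtain x where x: "x \<in> V" "norm x \<le> 2 * real m"
         "norm (t *\<^sub>R y - f x) < t * e"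
        using t e by auto
      have "t *\<^sub>R y - f x = t *\<^sub>R (y - f (x /\<^sub>R t))"
        using t by (simp add: f.scaleR scaleR_diff_right)
      then have "norm (y - f (x /\<^sub>R t)) < e"
        using x(3) t by simp
      moreover have "norm (x /\<^sub>R t) \<le> K * norm y"
      proof -
        have "norm (x /\<^sub>R t) \<le> 2 * real m / t"
          using x(2) t by (simp add: divide_simps)
        also have "\<dots> = 4 * real m / r * norm y"
          using r False by (simp add: t_def field_simps)
        also have "\<dots> \<le> K * norm y"
          by (intro mult_right_mono) (simp_all add: K_def)
        finally show ?thesis .
      qed
      ultimately show ?thesis
        using x(1) V by (intro bexI[of _ "x /\<^sub>R t"]) (auto simp: subspace_scale)
    qed
  qed
qed

lemma bounded_preimage:
  fixes f :: "'a::banach \<Rightarrow> 'b::banach"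
  assumes f: "bounded_linear f" and V: "subspace V" "closed V" and fV: "closed (f ` V)"
  obtains K where "\<And>y. y \<in> f ` V \<Longrightarrow> \<exists>x\<in>V. f x = y \<and> norm x \<le> K * norm y"
proof -
  interpret f: bounded_linear f
    by (rule f)
  let ?W = "f ` V"
  obtain K where K: "K > 0"
    and app: "\<And>y e. y \<in> ?W \<Longrightarrow> e > 0 \<Longrightarrow> \<exists>x\<in>V. norm x \<le> K * norm y \<and> norm (y - f x) < e"
    using approximate_preimage[OF f V(1) fV] by blast
  have "\<exists>x\<in>V. f x = y \<and> norm x \<le> 2 * K * norm y" if y: "y \<in> ?W" for y
  proof (cases "y = 0")
    case True
    then show ?thesis
      using V by (intro bexI[of _ 0]) (auto simp: f.zero subspace_0)
  next
    case False
    define e where "e k = norm y / 2 ^ k" for k :: nat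
    have e: "e k > 0" for k
      using False by (simp add: e_def)
    \<comment> \<open>\<open>g z k\<close> is a correction for the error \<open>z\<close>, leaving
      an error below \<open>e (Suc k)\<close>. In the recursion \<open>z k\<close> is the error
      after k corrections, of norm at most \<open>e k\<close>, so the corrections are dominated by a
      geometric series.\<close>
    define g where "g z k = (SOME x. x \<in> V \<and> norm x \<le> K * norm z \<and> norm (z - f x) < e (Suc k))" for z k
    have g: "g z k \<in> V \<and> norm (g z k) \<le> K * norm z \<and> norm (z - f (g z k)) < e (Suc k)" if "z \<in> ?W" for z k
      unfolding g_def by (rule someI_ex) (use app[OF that e] in blast)
    define z where "z = rec_nat y (\<lambda>k w. w - f (g w k))"
    have z: "z 0 = y" "z (Suc k) = z k - f (g (z k) k)" for k
      by (simp_all add: z_def)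
    have W: "subspace ?W"
      using V f.linear_axioms by (simp add: linear_subspace_image)
    have zW: "z k \<in> ?W" for k
      by (induction k) (use y W g in \<open>auto simp: z(1) z(2) intro!: subspace_diff\<close>)
    have zn: "norm (z k) \<le> e k" for k
      using g[OF zW] by (cases k) (auto simp: z e_def intro: less_imp_le)
    define x where "x k = g (z k) k" for k
    have xV: "x k \<in> V" and xn: "norm (x k) \<le> K * norm y * (1 / 2) ^ k" for k
    proof -
      show "x k \<in> V"
        using g[OF zW] by (simp add: x_def)
      have "norm (x k) \<le> K * norm (z k)"
        using g[OF zW] by (simp add: x_def)
      also have "\<dots> \<le> K * e k"
        using zn K by simp
      finally show "norm (x k) \<le> K * norm y * (1 / 2) ^ k"
        by (simp add: e_def field_simps)
    qed
    have geo: "(\<lambda>k. K * norm y * (1 / 2) ^ k) sums (K * norm y * 2)"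
      using geometric_sums[of "1 / 2 :: real"] by (intro sums_mult) simp
    have summ: "summable (\<lambda>k. norm (x k))"
      using sums_summable[OF geo] by (rule summable_comparison_test') (use xn in simp)
    have sums: "x sums suminf x"
      using summ by (simp add: summable_norm_cancel summable_sums)
    have partial: "f (\<Sum>k<n. x k) = y - z n" for n
      by (induction n) (simp_all add: f.zero f.add z x_def)
    have "z \<longlonglongrightarrow> 0"
    proof (rule Lim_null_comparison)
      show "\<forall>\<^sub>F n in sequentially. norm (z n) \<le> norm y * (1 / 2) ^ n"
        using zn by (simp add: e_def field_simps)
      show "(\<lambda>n. norm y * (1 / 2) ^ n) \<longlonglongrightarrow> 0"
        by (intro tendsto_mult_right_zero LIMSEQ_realpow_zero) auto
    qed
    then have "(\<lambda>n. f (\<Sum>k<n. x k)) \<longlonglongrightarrow> y - 0"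
      unfolding partial by (intro tendsto_diff tendsto_const)
    moreover have "(\<lambda>n. f (\<Sum>k<n. x k)) \<longlonglongrightarrow> f (suminf x)"
      using sums by (intro f.tendsto) (simp add: sums_def)
    ultimately have "f (suminf x) = y"
      using LIMSEQ_unique by fastforce
    moreover have "(\<Sum>k<n. x k) \<in> V" for n
      using xV V by (simp add: subspace_sum)
    then have "suminf x \<in> V"
      using sums V(2) closed_sequentially[of V "\<lambda>n. \<Sum>k<n. x k"] by (simp add: sums_def)
    moreover have "norm (suminf x) \<le> 2 * K * norm y"
    proof -
      have "norm (suminf x) \<le> (\<Sum>k. norm (x k))"
        using summ by (rule summable_norm)
      also have "\<dots> \<le> (\<Sum>k. K * norm y * (1 / 2) ^ k)"
        using xn summ geo by (intro suminf_le) (auto simp: sums_iff)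
      also have "\<dots> = 2 * K * norm y"
        using geo by (simp add: sums_iff)
      finally show ?thesis .
    qed
    ultimately show ?thesis
      by blast
  qed
  then show ?thesis
    by (rule that)
qed

text \<open>Openness in sequential form, the tool for the closedness proofs below: lift the null
  sequence y n - f v with norm control and add v.\<close>

lemma lift_convergent_sequence:
  fixes f :: "'a::banach \<Rightarrow> 'b::banach"
  assumes f: "bounded_linear f" and V: "subspace V" "closed V" and fV: "closed (f ` V)"
    and y: "\<And>n. y n \<in> f ` V" "y \<longlonglongrightarrow> f v" "v \<in> V"
  obtains x where "\<And>n. x n \<in> V" "\<And>n. f (x n) = y n" "x \<longlonglongrightarrow> v"
proof -
  interpret f: bounded_linear f
    by (rule f)
  obtain K where K: "\<And>y. y \<in> f ` V \<Longrightarrow> \<exists>x\<in>V. f x = y \<and> norm x \<le> K * norm y"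
    using bounded_preimage[OF f V fV] by blast
  have "subspace (f ` V)"
    using V f.linear_axioms by (simp add: linear_subspace_image)
  then have "\<forall>n. \<exists>x\<in>V. f x = y n - f v \<and> norm x \<le> K * norm (y n - f v)"
    using y by (intro allI K subspace_diff) auto
  then obtain u where u: "\<And>n. u n \<in> V" "\<And>n. f (u n) = y n - f v" "\<And>n. norm (u n) \<le> K * norm (y n - f v)"
    by metis
  have "(\<lambda>n. K * norm (y n - f v)) \<longlonglongrightarrow> 0"
    using y(2) by (intro tendsto_mult_right_zero tendsto_norm_zero LIM_zero)
  then have "u \<longlonglongrightarrow> 0"
    using u(3) by (intro Lim_null_comparison[of u]) auto
  then have "(\<lambda>n. u n + v) \<longlonglongrightarrow> 0 + v"
    by (intro tendsto_add tendsto_const)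
  then show ?thesis
    using u V y(3) by (intro that[of "\<lambda>n. u n + v"]) (auto simp: f.add subspace_add)
qed

lemma bop_bounded_linear: "bop f \<Longrightarrow> bounded_linear f"
  by (simp add: bop_def)

text \<open>Lift a convergent sequence of f(W) to a convergent one in V. The lifts lie in W + N(f),
  closed because the kernel is finite-dimensional, and the kernel part of their limit is invisible
  to f.\<close>

lemma closed_image_subspace:
  assumes f: "bop f" and V: "csubspace V" "closed V" "closed (f ` V)"
    and W: "csubspace W" "closed W" "W \<subseteq> V" and ker: "fin_cdim {x \<in> V. f x = 0}"
  shows "closed (f ` W)"
  unfolding closed_sequential_limits
proof (intro allI impI, elim conjE)
  fix y l assume "\<forall>n. y n \<in> f ` W" and lim: "y \<longlonglongrightarrow> l"
  then have y: "y n \<in> f ` W" for n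
    by simp
  note lin = bop_clinear[OF f]
  let ?N = "{x \<in> V. f x = 0}"
  have N: "csubspace ?N"
    using lin V by (intro csubspace_kernel)
  define w where "w n = inv_into W f (y n)" for n
  have w: "w n \<in> W" "f (w n) = y n" for n
    using y[of n] by (simp_all add: w_def inv_into_into f_inv_into_f)
  have yV: "y n \<in> f ` V" for n
    using y[of n] W(3) by auto
  have "l \<in> f ` V"
    by (rule closed_sequentially[OF V(3) yV lim])
  then obtain v where v: "v \<in> V" "l = f v"
    by blast
  obtain x where x: "\<And>n. x n \<in> V" "\<And>n. f (x n) = y n" "x \<longlonglongrightarrow> v"
    using lift_convergent_sequence[where y = y, OF bop_bounded_linear[OF f] csubspace_imp_subspace[OF V(1)]
      V(2,3) yV _ v(1)] lim v(2) by blast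
  have diff: "x n - w n \<in> ?N" for n
    using x(1,2)[of n] w[of n] W(3) by (auto simp: cvp.linear_diff[OF lin] intro!: cvs.subspace_diff[OF V(1)])
  have mem: "x n \<in> cspan (W \<union> ?N)" for n
    using w(1) diff by (rule cspan_UnI)
  have "closed (cspan (W \<union> ?N))"
    using W cvs.span_superset[of "W \<union> ?N"]
    by (intro closed_fin_mod[OF W(1,2) _ _ fin_mod_Un_fin_cdim[OF ker]]) auto
  then have "v \<in> cspan (W \<union> ?N)"
    by (rule closed_sequentially[OF _ mem x(3)])
  then obtain a b where "a \<in> W" "b \<in> ?N" "v = a + b"
    using csubspace_sum_iff[OF W(1) N] by blast
  then show "l \<in> f ` W"
    using v(2) cvp.linear_add[OF lin] by auto
qed

text \<open>Neubauer's lemma: lifting along \<open>(x, b) \<mapsto> S x + b\<close> shows that the \<open>B\<close>-component of a limit of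
  elements of \<open>range S\<close> is a limit of elements of the closed set \<open>range S \<inter> B\<close>.\<close>

lemma closed_range_if_closed_sum:
  assumes S: "bop S" and B: "csubspace B" "closed B" and sum: "closed (cspan (range S \<union> B))"
    and fin: "fin_cdim (range S \<inter> B)"
  shows "closed (range S)"
  unfolding closed_sequential_limits
proof (intro allI impI, elim conjE)
  fix a l assume "\<forall>n. a n \<in> range S" and lim: "a \<longlonglongrightarrow> l"
  then have a: "a n \<in> range S" for n
    by simp
  note lin = bop_clinear[OF S]
  have R: "csubspace (range S)"
    using lin by (intro csubspace_image csubspace_UNIV)
  define f where "f = (\<lambda>(x, b). S x + b)"
  have f: "bounded_linear f"
    unfolding f_def split_def
    by (rule bounded_linear_add[OF bounded_linear_compose[OF bop_bounded_linear[OF S] bounded_linear_fst]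
      bounded_linear_snd])
  have im: "f ` (UNIV \<times> B) = cspan (range S \<union> B)"
    by (auto simp: csubspace_sum_iff[OF R B(1)] f_def image_iff) blast
  have V: "subspace (UNIV \<times> B)" "closed (UNIV \<times> B)"
    using B by (auto intro!: subspace_Times closed_Times csubspace_imp_subspace)
  have a': "a n \<in> cspan (range S \<union> B)" for n
    using a by (simp add: cvs.span_base)
  have l': "l \<in> cspan (range S \<union> B)"
    by (rule closed_sequentially[OF sum a' lim])
  then obtain u b where b: "b \<in> B" "l = S u + b"
    using csubspace_sum_iff[OF R B(1)] by auto
  have "b \<in> range S \<inter> B"
  proof -
    define y where "y n = a n - l" for n
    have f0: "f (0, 0) = 0"
      using lin by (simp add: f_def cvp.linear_0)
    have y0: "y \<longlonglongrightarrow> 0"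
      unfolding y_def using lim by (simp add: LIM_zero)
    have yim: "y n \<in> f ` (UNIV \<times> B)" for n
      unfolding im y_def using a' l' by (rule cvs.span_diff)
    have "closed (f ` (UNIV \<times> B))" "(0, 0) \<in> UNIV \<times> B" "y \<longlonglongrightarrow> f (0, 0)"
      using sum B(1) y0 by (simp_all add: im f0 cvs.subspace_0)
    then obtain p where p: "\<And>n. p n \<in> UNIV \<times> B" "\<And>n. f (p n) = y n" "p \<longlonglongrightarrow> (0, 0)"
      using lift_convergent_sequence[where y = y, OF f V _ yim] by blast
    \<comment> \<open>The left side shows membership in \<open>B\<close>, the right side membership
      in \<open>range S\<close>.\<close>
    have eq: "b + snd (p n) = (a n - S u) - S (fst (p n))" for n
      using p(2)[of n] b(2) by (simp add: f_def y_def split_def algebra_simps)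
    have "b + snd (p n) \<in> B" for n
      using p(1)[of n] b(1) B(1) by (auto intro: cvs.subspace_add)
    moreover have "b + snd (p n) \<in> range S" for n
      unfolding eq using a by (intro cvs.subspace_diff[OF R]) auto
    ultimately have mem: "b + snd (p n) \<in> range S \<inter> B" for n
      by simp
    have conv: "(\<lambda>n. b + snd (p n)) \<longlonglongrightarrow> b + 0"
      using tendsto_snd[OF p(3)] by (intro tendsto_add tendsto_const) simp
    have "closed (range S \<inter> B)"
      using fin R B by (intro closed_fin_cdim cvs.subspace_inter)
    from closed_sequentially[OF this mem conv] show ?thesis
      by simp
  qed
  then show "l \<in> range S"
    using b R by (auto intro: cvs.subspace_add)
qed

lemma closed_range_funpow:
  assumes S: "bop S" and cl: "closed (range (S ^^ k))" "closed (range (S ^^ Suc k))"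
    and ker: "fin_cdim {x \<in> range (S ^^ k). S x = 0}"
  shows "closed (range (S ^^ (j + k)))"
proof (induction j)
  case (Suc j)
  have "closed (S ` range (S ^^ (j + k)))"
  proof (rule closed_image_subspace[OF S _ cl(1) _ _ Suc _ ker])
    show "closed (S ` range (S ^^ k))"
      using cl(2) by (simp only: image_range_funpow)
    show "range (S ^^ (j + k)) \<subseteq> range (S ^^ k)"
      by (rule range_funpow_mono) simp
  qed (intro csubspace_range_funpow bop_clinear S)+
  then show ?case
    by (simp only: image_range_funpow add_Suc)
qed (use cl in simp)

text \<open>Relative closedness in a closed range is closedness in the whole space, so the condition
  concerns two consecutive ranges.\<close>

lemma upper_sf_on_range_iff:
  "closed (range (S ^^ k)) \<and> upper_sf_on (range (S ^^ k)) S \<longleftrightarrow>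
    closed (range (S ^^ k)) \<and> closed (range (S ^^ Suc k)) \<and> fin_cdim {x \<in> range (S ^^ k). S x = 0}"
  unfolding upper_sf_on_def qdim_finite fin_mod_zero image_range_funpow
  using range_funpow_mono[of k "Suc k" S] closedin_closed_eq by (metis Suc_n_not_le_n nat_le_linear)

lemma lower_sf_on_range_iff:
  "closed (range (S ^^ k)) \<and> lower_sf_on (range (S ^^ k)) S \<longleftrightarrow>
    closed (range (S ^^ k)) \<and> closed (range (S ^^ Suc k)) \<and> fin_mod (range (S ^^ k)) (S ` range (S ^^ k))"
  unfolding lower_sf_on_def qdim_finite image_range_funpow
  using range_funpow_mono[of k "Suc k" S] closedin_closed_eq by (metis Suc_n_not_le_n nat_le_linear)

text \<open>Frees the index from the least admissible power;
  \<open>ind_on_range_perturbation\<close> then compares arbitrary powers.\<close>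

lemma bind_attained:
  assumes "sbf S"
  obtains k where "bind S = ind_on (range (S ^^ k)) S"
    "nul (range (S ^^ k)) S \<noteq> \<infinity> \<or> dfc (range (S ^^ k)) S \<noteq> \<infinity>"
proof -
  let ?P = "\<lambda>k. closed (range (S ^^ k)) \<and> (upper_sf_on (range (S ^^ k)) S \<or> lower_sf_on (range (S ^^ k)) S)"
  have "\<exists>k. ?P k"
    using assms by (auto simp: sbf_def upper_sbf_def lower_sbf_def)
  then have "?P (LEAST k. ?P k)"
    by (rule LeastI_ex)
  then show ?thesis
    by (intro that[of "LEAST k. ?P k"])
      (auto simp: bind_def upper_sf_on_def lower_sf_on_def nul_def dfc_def)
qed

section \<open>Closed ranges and semi-B-Fredholmness of the perturbed operator\<close>

context commuting_perturbation
begin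

text \<open>On V0, the part of R(T^k) inside N(F^n), the operator T^(j+n) factors as A G^j, so its
  closed image and finite-dimensional kernel control G^j. Since V0 has finite codimension in R(T^k),
  closedness passes to the full image.\<close>

lemma closed_image_G_funpow:
  assumes cl: "closed (range (T ^^ k))" "closed (range (T ^^ Suc k))"
    and ker: "fin_cdim {x \<in> range (T ^^ k). T x = 0}"
  shows "closed ((G ^^ j) ` range (T ^^ k))"
proof -
  let ?V = "range (T ^^ k)" and ?f = "T ^^ (j + n)"
  define V0 where "V0 = {x \<in> ?V. (F ^^ n) x = 0}"
  have V: "csubspace ?V" "invariant ?V"
    using invariant_range_T[of k] by (simp_all only: invariant_csubspace)
  have linF: "clinear (F ^^ n)" and linG: "clinear (G ^^ j)" and linT: "clinear ?f"
    by (intro clinear_funpow lin)+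
  have V0: "csubspace V0" "V0 \<subseteq> ?V"
    unfolding V0_def using csubspace_kernel[OF linF V(1)] by auto
  have "V0 = ?V \<inter> (F ^^ n) -` {0}"
    by (auto simp: V0_def)
  then have clV0: "closed V0"
    using cl(1) continuous_closed_vimage[of "{0}" "F ^^ n"] bop_funpow[OF F, of n]
    by (auto simp: bop_def linear_continuous_at)
  have "fin_mod ((F ^^ n) ` ?V) {0}"
    using fin by (auto simp: fin_mod_zero intro: fin_cdim_subset)
  from fin_mod_vimage[OF linF V(1) cvs.subspace_single_0 this] have fin_V: "fin_mod ?V V0"
    by (simp add: V0_def)
  obtain A B where A: "bop A" "\<And>x. A (G x) = G (A x)"
    and AB: "\<And>x. ?f x = (G ^^ j) (A x) + B x" "\<And>x. (F ^^ n) x = 0 \<Longrightarrow> B x = 0"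
    using T_funpow_decomposition[OF V(2), of j] by metis
  have f_eq: "?f x = A ((G ^^ j) x)" if "x \<in> V0" for x
    using that AB A(2) funpow_commute[of G A j x] by (simp add: V0_def)
  have kerf: "fin_cdim {x \<in> ?V. ?f x = 0}"
    using fin_cdim_kernel_funpow[OF lin(1) V(1) invariant_T[OF V(2)] ker] .
  have "closed (?f ` ?V)"
    using closed_range_funpow[OF T cl ker] by (simp only: funpow_image_range)
  then have clf: "closed (?f ` V0)"
    by (intro closed_image_subspace[OF bop_funpow[OF T] V(1) cl(1) _ V0(1) clV0 V0(2) kerf])
  define N where "N = {x \<in> V0. ?f x = 0}"
  have N: "csubspace N" "fin_cdim N" "N \<subseteq> V0"
    unfolding N_def using csubspace_kernel[OF linT V0(1)] V0(2)
    by (auto intro!: fin_cdim_subset[OF kerf])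
  have GN: "csubspace ((G ^^ j) ` N)" "closed ((G ^^ j) ` N)"
  proof -
    show *: "csubspace ((G ^^ j) ` N)"
      using N linG by (intro csubspace_image)
    have "fin_mod ((G ^^ j) ` N) ((G ^^ j) ` {0})"
      using N linG by (intro fin_mod_image) (simp_all only: fin_mod_zero)
    then show "closed ((G ^^ j) ` N)"
      using * cvp.linear_0[OF linG] by (intro closed_fin_cdim) (simp_all add: fin_mod_zero)
  qed
  have clG: "closed ((G ^^ j) ` V0)"
    unfolding closed_sequential_limits
  proof (intro allI impI, elim conjE)
    fix y l assume "\<forall>i. y i \<in> (G ^^ j) ` V0" and lim: "y \<longlonglongrightarrow> l"
    then have y: "y i \<in> (G ^^ j) ` V0" for i
      by simp
    define v where "v i = inv_into V0 (G ^^ j) (y i)" for i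
    have v: "v i \<in> V0" "(G ^^ j) (v i) = y i" for i
      using y[of i] by (simp_all only: v_def inv_into_into f_inv_into_f)
    have im: "A (y i) \<in> ?f ` V0" for i
      using v[of i] f_eq[of "v i"] by (metis imageI)
    have "bounded_linear A"
      using A(1) by (rule bop_bounded_linear)
    then have limA: "(\<lambda>i. A (y i)) \<longlonglongrightarrow> A l"
      using lim by (rule bounded_linear.tendsto)
    have "A l \<in> ?f ` V0"
      by (rule closed_sequentially[OF clf im limA])
    then obtain u where u: "u \<in> V0" "A l = ?f u"
      by blast
    obtain x where x: "\<And>i. x i \<in> V0" "\<And>i. ?f (x i) = A (y i)" "x \<longlonglongrightarrow> u"
      using lift_convergent_sequence[where y = "\<lambda>i. A (y i)", OF bop_bounded_linear[OF bop_funpow[OF T]]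
        csubspace_imp_subspace[OF V0(1)] clV0 clf im _ u(1)] limA u(2) by metis
    \<comment> \<open>\<open>v i\<close> and \<open>x i\<close> have the same image under T^(j+n),
      so they differ by an element of N. The difference y i - G^j (x i) stays in the closed space
      G^j(N), although the \<open>v i\<close> themselves need not converge.\<close>
    have mem: "y i - (G ^^ j) (x i) \<in> (G ^^ j) ` N" for i
    proof
      show "y i - (G ^^ j) (x i) = (G ^^ j) (v i - x i)"
        by (simp only: cvp.linear_diff[OF linG] v)
      have "?f (v i - x i) = 0"
        by (simp only: cvp.linear_diff[OF linT] f_eq[OF v(1)] v(2) x(2) diff_self)
      then show "v i - x i \<in> N"
        using cvs.subspace_diff[OF V0(1) v(1) x(1)] by (simp only: N_def) blast
    qed
    have "(\<lambda>i. (G ^^ j) (x i)) \<longlonglongrightarrow> (G ^^ j) u"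
      using bop_bounded_linear[OF bop_funpow[OF G]] x(3) by (rule bounded_linear.tendsto)
    with lim have "(\<lambda>i. y i - (G ^^ j) (x i)) \<longlonglongrightarrow> l - (G ^^ j) u"
      by (rule tendsto_diff)
    then have "l - (G ^^ j) u \<in> (G ^^ j) ` N"
      by (rule closed_sequentially[OF GN(2) mem])
    then obtain w where w: "w \<in> N" "l - (G ^^ j) u = (G ^^ j) w"
      by blast
    show "l \<in> (G ^^ j) ` V0"
    proof
      show "l = (G ^^ j) (u + w)"
        using w(2) by (simp add: cvp.linear_add[OF linG] algebra_simps)
      show "u + w \<in> V0"
        using u(1) w(1) N(3) cvs.subspace_add[OF V0(1)] by blast
    qed
  qed
  show ?thesis
    by (rule closed_fin_mod[OF csubspace_image[OF linG V0(1)] clG csubspace_image[OF linG V(1)]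
          image_mono[OF V0(2)] fin_mod_image[OF linG fin_V]])
qed

text \<open>Neubauer's lemma with N(T^k) as the second summand. The bound k + n \<le> j puts R(G^j)
  inside R(T^k) up to finitely many dimensions, where N(T^k) is finite-dimensional.\<close>

lemma closed_range_G_upper:
  assumes cl: "closed (range (T ^^ k))" "closed (range (T ^^ Suc k))"
    and ker: "fin_cdim {x \<in> range (T ^^ k). T x = 0}"
    and j: "k + n \<le> j"
  shows "closed (range (G ^^ j))"
proof -
  let ?N = "{x. (T ^^ k) x = 0}"
  have linTk: "clinear (T ^^ k)"
    by (intro clinear_funpow lin)
  have cont: "continuous_on UNIV (T ^^ k)"
    using bop_bounded_linear[OF bop_funpow[OF T]] by (rule linear_continuous_on)
  have N: "csubspace ?N" "closed ?N"
    using csubspace_kernel[OF linTk csubspace_UNIV] closed_Collect_eq[OF cont continuous_on_const]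
    by simp_all
  have comm_pow: "(T ^^ k) ((G ^^ j) x) = (G ^^ j) ((T ^^ k) x)" for x
    by (intro funpow_commute[symmetric] funpow_commute commG)
  have "cspan (range (G ^^ j) \<union> ?N) = (T ^^ k) -` ((G ^^ j) ` range (T ^^ k))"
  proof (rule antisym)
    show "cspan (range (G ^^ j) \<union> ?N) \<subseteq> (T ^^ k) -` ((G ^^ j) ` range (T ^^ k))"
    proof (rule cvs.span_minimal)
      show "csubspace ((T ^^ k) -` ((G ^^ j) ` range (T ^^ k)))"
        by (intro cvp.linear_subspace_vimage csubspace_image clinear_funpow lin csubspace_UNIV)
      have "0 \<in> (G ^^ j) ` range (T ^^ k)"
        by (intro cvs.subspace_0 csubspace_image clinear_funpow lin csubspace_UNIV)
      then show "range (G ^^ j) \<union> ?N \<subseteq> (T ^^ k) -` ((G ^^ j) ` range (T ^^ k))"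
        by (auto simp: comm_pow)
    qed
    show "(T ^^ k) -` ((G ^^ j) ` range (T ^^ k)) \<subseteq> cspan (range (G ^^ j) \<union> ?N)"
    proof
      fix x assume "x \<in> (T ^^ k) -` ((G ^^ j) ` range (T ^^ k))"
      then obtain z where "(T ^^ k) x = (T ^^ k) ((G ^^ j) z)"
        by (auto simp: comm_pow)
      then have "x - (G ^^ j) z \<in> ?N"
        by (simp add: cvp.linear_diff[OF linTk])
      then show "x \<in> cspan (range (G ^^ j) \<union> ?N)"
        by (rule cspan_UnI[rotated]) simp
    qed
  qed
  then have "closed (cspan (range (G ^^ j) \<union> ?N))"
    using closed_vimage[OF closed_image_G_funpow[OF cl ker] cont] by simp
  moreover have "fin_cdim (range (G ^^ j) \<inter> ?N)"
  proof -
    have "fin_cdim {x \<in> range (T ^^ k). (T ^^ k) x = 0}"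
      using invariant_range_T[of k] ker
      by (intro fin_cdim_kernel_funpow lin invariant_csubspace invariant_T)
    then have "fin_cdim (range (G ^^ (k + n)) \<inter> ?N)"
      by (intro fin_cdim_Int_range_G N) (auto intro: fin_cdim_subset)
    then show ?thesis
      by (rule fin_cdim_subset) (use range_funpow_mono[OF j, of G] in auto)
  qed
  ultimately show ?thesis
    using bop_funpow[OF G] N by (intro closed_range_if_closed_sum[of "G ^^ j" ?N])
qed

text \<open>R(G^j) and the closed space R(T^k) differ by finitely many dimensions. So their sum U is
  closed, and adding a finite-dimensional space to R(G^j) gives a closed space; Neubauer's lemma
  applies with that space.\<close>

lemma closed_range_G_lower:
  assumes cl: "closed (range (T ^^ k))" and ran: "fin_mod (range (T ^^ k)) (T ` range (T ^^ k))"
    and j: "k + n \<le> j"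
  shows "closed (range (G ^^ j))"
proof -
  let ?V = "range (T ^^ k)" and ?R = "range (G ^^ j)"
  have sub: "csubspace ?V" "csubspace ?R"
    by (intro csubspace_range_funpow lin)+
  have RV: "fin_mod ?R ?V"
    using fin_mod_range_G range_funpow_mono[OF j, of G] by (rule fin_mod_mono) simp
  have VR: "fin_mod ?V ?R"
    using ran by (rule fin_mod_ranges)
  define U where "U = cspan (?V \<union> ?R)"
  have U: "csubspace U" "?V \<subseteq> U" "?R \<subseteq> U"
    using cvs.span_superset[of "?V \<union> ?R"] by (auto simp: U_def)
  have "closed U"
    using U(1,2) RV by (intro closed_fin_mod[OF sub(1) cl]) (simp_all add: U_def fin_mod_Un fin_mod_subset)
  moreover have "fin_mod U ?R"
    using VR by (simp add: U_def fin_mod_Un fin_mod_subset)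
  then obtain S where S: "finite S" "U \<subseteq> cspan (?R \<union> S)"
    by (auto simp: fin_mod_def)
  ultimately have "closed (cspan (U \<union> S))"
    using U(1) by (intro closed_cspan_Un_finite)
  moreover have "cspan (U \<union> S) = cspan (?R \<union> cspan S)"
  proof (rule antisym; rule cvs.span_minimal[OF _ cvs.subspace_span])
    have "cspan (?R \<union> S) \<subseteq> cspan (?R \<union> cspan S)"
      using cvs.span_superset[of S] by (intro cvs.span_mono) auto
    then show "U \<union> S \<subseteq> cspan (?R \<union> cspan S)"
      using S(2) cvs.span_superset[of "?R \<union> S"] by auto
    show "?R \<union> cspan S \<subseteq> cspan (U \<union> S)"
      using U(3) cvs.span_superset[of "U \<union> S"] cvs.span_mono[of S "U \<union> S"] by auto
  qed
  moreover have fin_S: "fin_cdim (cspan S)"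
    using S(1) by (auto simp: fin_cdim_def)
  moreover have "closed (cspan S)"
    using fin_S by (intro closed_fin_cdim) simp_all
  ultimately show ?thesis
    using bop_funpow[OF G] by (intro closed_range_if_closed_sum[of "G ^^ j" "cspan S"])
      (auto intro: fin_cdim_subset)
qed

lemma upper_sbf_G: "upper_sbf T \<Longrightarrow> upper_sbf G"
proof -
  assume "upper_sbf T"
  then obtain k where k: "closed (range (T ^^ k))" "closed (range (T ^^ Suc k))"
      "fin_cdim {x \<in> range (T ^^ k). T x = 0}"
    unfolding upper_sbf_def upper_sf_on_range_iff by blast
  then show "upper_sbf G"
    unfolding upper_sbf_def upper_sf_on_range_iff
    using closed_range_G_upper[OF k, of "k + n"] closed_range_G_upper[OF k, of "Suc (k + n)"]
      fin_cdim_kernel_range_G[OF k(3)]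
    by (intro exI[of _ "k + n"]) (simp del: funpow.simps)
qed

lemma lower_sbf_G: "lower_sbf T \<Longrightarrow> lower_sbf G"
proof -
  assume "lower_sbf T"
  then obtain k where k: "closed (range (T ^^ k))" "fin_mod (range (T ^^ k)) (T ` range (T ^^ k))"
    unfolding lower_sbf_def lower_sf_on_range_iff by blast
  then show "lower_sbf G"
    unfolding lower_sbf_def lower_sf_on_range_iff
    using closed_range_G_lower[OF k, of "k + n"] closed_range_G_lower[OF k, of "Suc (k + n)"]
      fin_mod_range_G_step[OF k(2)]
    by (intro exI[of _ "k + n"]) (simp del: funpow.simps)
qed

lemma bind_G: "sbf T \<Longrightarrow> bind G = bind T"
proof -
  assume T: "sbf T"
  then have "sbf G"
    using upper_sbf_G lower_sbf_G by (auto simp: sbf_def)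
  then show "bind G = bind T"
    using ind_on_range_perturbation by (metis T bind_attained)
qed

end

section \<open>Hyperrange and hyperkernel\<close>

text \<open>Adding a finite-dimensional space commutes with decreasing intersections. For a single
  vector v outside some M m, the coefficient of v in a decomposition is determined by M m, so one
  coefficient serves all k.\<close>

lemma Inter_cspan_decreasing:
  assumes M: "\<And>k. csubspace (M k)" "decseq M" and "finite S"
  shows "(\<Inter>k. cspan (M k \<union> S)) \<subseteq> cspan ((\<Inter>k. M k) \<union> S)"
  using assms(3) M
proof (induction S arbitrary: M)
  case empty
  have "csubspace (\<Inter>k. M k)"
    using empty by (intro cvs.subspace_Inter) auto
  then show ?case
    using empty by (simp add: cvs.span_eq_iff[THEN iffD2])
next
  case (insert v S)
  have ins: "cspan (N \<union> insert v S) = cspan (cspan (insert v N) \<union> S)" for N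
    using cspan_Un_cspan[of "insert v N" S] by simp
  let ?M = "\<lambda>k. cspan (insert v (M k))"
  have "decseq ?M"
    using insert.prems(2) by (auto simp: decseq_def intro!: cvs.span_mono)
  then have "(\<Inter>k. cspan (?M k \<union> S)) \<subseteq> cspan ((\<Inter>k. ?M k) \<union> S)"
    by (intro insert.IH) simp_all
  moreover have "(\<Inter>k. ?M k) \<subseteq> cspan (insert v (\<Inter>k. M k))"
  proof
    fix x assume x: "x \<in> (\<Inter>k. ?M k)"
    have mem: "y \<in> ?M k \<longleftrightarrow> (\<exists>c. y - scaleC c v \<in> M k)" for y k
      using insert.prems(1) by (simp add: cvs.span_insert cvs.span_eq_iff[THEN iffD2])
    show "x \<in> cspan (insert v (\<Inter>k. M k))"
    proof (cases "\<forall>k. v \<in> M k")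
      case True
      then have "insert v (M k) = M k" for k
        by auto
      then have "x \<in> (\<Inter>k. M k)"
        using x insert.prems(1) by (simp add: cvs.span_eq_iff[THEN iffD2])
      then show ?thesis
        by (intro cvs.span_base) simp
    next
      case False
      then obtain m where m: "v \<notin> M m"
        by blast
      have ex: "\<exists>c. x - scaleC c v \<in> M k" for k
        using x mem by auto
      obtain c where c: "x - scaleC c v \<in> M m"
        using ex by blast
      \<comment> \<open>At level max m k, a coefficient d other than c would put a nonzero multiple
        of v into M m.\<close>
      have "x - scaleC c v \<in> M k" for k
      proof -
        obtain d where d: "x - scaleC d v \<in> M (max m k)"
          using ex by blast
        have le: "M (max m k) \<subseteq> M m" "M (max m k) \<subseteq> M k"
          using insert.prems(2) by (auto simp: decseq_def)
        have "(x - scaleC c v) - (x - scaleC d v) \<in> M m"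
          using d le by (intro cvs.subspace_diff[OF insert.prems(1) c]) auto
        then have "scaleC (d - c) v \<in> M m"
          by (simp add: cvs.scale_left_diff_distrib)
        then have "scaleC (inverse (d - c)) (scaleC (d - c) v) \<in> M m"
          by (rule cvs.subspace_scale[OF insert.prems(1)])
        then have "d = c"
          using m by (cases "d = c") (simp_all add: scaleC_scaleC scaleC_one)
        then show ?thesis
          using d le by auto
      qed
      then show ?thesis
        using mem by (simp add: cvs.span_insert) (meson INT_I UNIV_I cvs.span_base)
    qed
  qed
  then have "cspan ((\<Inter>k. ?M k) \<union> S) \<subseteq> cspan (cspan (insert v (\<Inter>k. M k)) \<union> S)"
    by (intro cvs.span_mono) auto
  ultimately show ?case
    by (simp only: ins)
qed

lemma hyperrange_eq: "hyperrange S = (\<Inter>k. range (S ^^ k))"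
proof -
  have "(\<Inter>n\<in>{1..}. range (S ^^ n)) \<subseteq> range (S ^^ k)" for k
    using range_funpow_mono[of k "Suc k" S] by force
  then show ?thesis
    by (auto simp: hyperrange_def)
qed

lemma hyperkernel_eq: "hyperkernel S = (\<Union>k. {x. (S ^^ k) x = 0})" if "clinear S"
proof -
  have "(S ^^ k) x = 0 \<Longrightarrow> (S ^^ Suc k) x = 0" for k x
    using that by (simp add: cvp.linear_0)
  then show ?thesis
    unfolding hyperkernel_def by (auto simp del: funpow.simps)
qed

lemma csubspace_hyperrange: "clinear S \<Longrightarrow> csubspace (hyperrange S)"
  unfolding hyperrange_eq by (intro cvs.subspace_Inter) (auto intro: csubspace_range_funpow)

lemma csubspace_hyperkernel:
  assumes "clinear S"
  shows "csubspace (hyperkernel S)"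
proof -
  have mono: "(S ^^ (i + k)) x = 0" if "(S ^^ k) x = 0" for i k x
    using that assms by (induction i) (auto simp: cvp.linear_0)
  have lin: "clinear (S ^^ k)" for k
    using assms by (rule clinear_funpow)
  show ?thesis
    unfolding hyperkernel_eq[OF assms] cvs.subspace_def
  proof (intro conjI ballI allI)
    show "0 \<in> (\<Union>k. {x. (S ^^ k) x = 0})"
      using cvp.linear_0[OF lin] by auto
    fix x y assume "x \<in> (\<Union>k. {x. (S ^^ k) x = 0})" "y \<in> (\<Union>k. {x. (S ^^ k) x = 0})"
    then obtain k j where "(S ^^ k) x = 0" "(S ^^ j) y = 0"
      by blast
    then have "(S ^^ (k + j)) (x + y) = 0"
      using mono[of k x j] mono[of j y k] cvp.linear_add[OF lin] by (simp add: add.commute)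
    then show "x + y \<in> (\<Union>k. {x. (S ^^ k) x = 0})"
      by blast
  next
    fix c x assume "x \<in> (\<Union>k. {x. (S ^^ k) x = 0})"
    then show "scaleC c x \<in> (\<Union>k. {x. (S ^^ k) x = 0})"
      using cvp.linear_scale[OF lin] by auto
  qed
qed

lemma csubspace_closure:
  assumes V: "csubspace V"
  shows "csubspace (closure V)"
proof -
  have "0 \<in> closure V"
    using V closure_subset[of V] by (auto simp: cvs.subspace_0)
  moreover have "x + y \<in> closure V" if xy: "x \<in> closure V" "y \<in> closure V" for x y
  proof -
    obtain u v where "\<And>n. u n \<in> V" "u \<longlonglongrightarrow> x" "\<And>n. v n \<in> V" "v \<longlonglongrightarrow> y"
      using xy unfolding closure_sequential by blast
    then show ?thesis
      using V unfolding closure_sequential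
      by (intro exI[of _ "\<lambda>n. u n + v n"]) (simp add: cvs.subspace_add tendsto_add)
  qed
  moreover have "scaleC c x \<in> closure V" if x: "x \<in> closure V" for c x
  proof -
    obtain y where y: "\<And>n. y n \<in> V" "y \<longlonglongrightarrow> x"
      using x unfolding closure_sequential by blast
    have "bounded_linear (scaleC c :: 'a \<Rightarrow> 'a)"
    proof (rule bounded_linear_intro[of _ "cmod c"])
      show "scaleC c (r *\<^sub>R x) = r *\<^sub>R scaleC c x" for r and x :: 'a
        by (simp add: scaleC_of_real[symmetric] scaleC_scaleC mult.commute)
    qed (simp_all add: scaleC_add_right norm_scaleC mult.commute)
    then have "(\<lambda>n. scaleC c (y n)) \<longlonglongrightarrow> scaleC c x"
      using y(2) by (rule bounded_linear.tendsto)
    moreover have "scaleC c (y n) \<in> V" for n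
      using y(1) V by (intro cvs.subspace_scale)
    ultimately show ?thesis
      unfolding closure_sequential by (intro exI[of _ "\<lambda>n. scaleC c (y n)"]) simp
  qed
  ultimately show ?thesis
    by (auto simp: cvs.subspace_def)
qed

lemma fin_mod_closure:
  assumes V: "csubspace V" and fin: "fin_mod U V"
  shows "fin_mod (closure U) (closure V)"
proof -
  obtain S where S: "finite S" "U \<subseteq> cspan (V \<union> S)"
    using fin by (auto simp: fin_mod_def)
  have "cspan (V \<union> S) \<subseteq> cspan (closure V \<union> S)"
    using closure_subset[of V] by (intro cvs.span_mono) auto
  then have "closure U \<subseteq> cspan (closure V \<union> S)"
    using S V by (intro closure_minimal closed_cspan_Un_finite csubspace_closure) auto
  then show ?thesis
    using S(1) by (auto simp: fin_mod_def)
qed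

lemma qdim_sum_Int_finite:
  assumes "csubspace A" "csubspace B" "fin_mod A (A \<inter> B)" "fin_mod B (A \<inter> B)"
  shows "qdim {x + y | x y. x \<in> A \<and> y \<in> B} (A \<inter> B) < \<infinity>"
proof -
  have "{x + y | x y. x \<in> A \<and> y \<in> B} = cspan (A \<union> B)"
    using csubspace_sum_iff[OF assms(1,2)] by blast
  then show ?thesis
    unfolding qdim_finite using fin_mod_Un[OF assms(3,4)] by simp
qed

section \<open>Hyperrange and closed hyperkernel under the perturbation\<close>

context commuting_perturbation
begin

text \<open>One finite set spanning R(F^n) works for all powers, which permits passing to the
  intersection.\<close>

lemma fin_mod_hyperrange_G: "fin_mod (hyperrange G) (hyperrange G \<inter> hyperrange T)"
proof -
  obtain S where S: "finite S" "range (F ^^ n) \<subseteq> cspan S"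
    using fin by (auto simp: fin_cdim_def)
  have "hyperrange G \<subseteq> (\<Inter>k. cspan (range (T ^^ k) \<union> S))"
  proof (rule INT_greatest)
    fix k
    have "hyperrange G \<subseteq> range (G ^^ (k + n))"
      unfolding hyperrange_eq by blast
    also have "\<dots> \<subseteq> cspan (range (T ^^ k) \<union> range (F ^^ n))"
      by (rule range_G_funpow)
    also have "\<dots> \<subseteq> cspan (range (T ^^ k) \<union> S)"
      using S(2) cvs.span_superset[of "range (T ^^ k) \<union> S"] cvs.span_mono[of S "range (T ^^ k) \<union> S"]
      by (intro cvs.span_minimal) auto
    finally show "hyperrange G \<subseteq> cspan (range (T ^^ k) \<union> S)" .
  qed
  also have "\<dots> \<subseteq> cspan (hyperrange T \<union> S)"
    unfolding hyperrange_eq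
    by (intro Inter_cspan_decreasing S(1) csubspace_range_funpow lin) (simp add: decseq_def range_funpow_mono)
  finally have "fin_mod (hyperrange G) (hyperrange T)"
    using S(1) by (auto simp: fin_mod_def)
  from fin_mod_Int[OF _ _ _ this, of "hyperrange G"] show ?thesis
    by (simp add: csubspace_hyperrange Int_commute)
qed

text \<open>N(F^n) cuts out a part of finite codimension. There T^k x = 0 gives G^(k+n) x = A T^k x
  + B F^n x = 0, because A and B commute with T and F.\<close>

lemma fin_mod_hyperkernel_T: "fin_mod (hyperkernel T) (hyperkernel T \<inter> hyperkernel G)"
proof -
  have sub: "csubspace (hyperkernel T)"
    by (intro csubspace_hyperkernel lin)
  have linF: "clinear (F ^^ n)"
    by (intro clinear_funpow lin)
  have "fin_mod ((F ^^ n) ` hyperkernel T) {0}"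
    using fin by (auto simp: fin_mod_zero intro: fin_cdim_subset)
  then have "fin_mod (hyperkernel T) {x \<in> hyperkernel T. (F ^^ n) x \<in> {0}}"
    by (intro fin_mod_vimage linF sub cvs.subspace_single_0)
  moreover have "{x \<in> hyperkernel T. (F ^^ n) x \<in> {0}} \<subseteq> hyperkernel T \<inter> hyperkernel G"
  proof
    fix x assume "x \<in> {x \<in> hyperkernel T. (F ^^ n) x \<in> {0}}"
    then have x: "x \<in> hyperkernel T" "(F ^^ n) x = 0"
      by simp_all
    then obtain k where k: "(T ^^ k) x = 0"
      by (auto simp: hyperkernel_eq)
    obtain A B where AB: "in_algebra A" "in_algebra B" "\<And>x. (G ^^ (k + n)) x = (T ^^ k) (A x) + (F ^^ n) (B x)"
      using funpow_add_decomposition[of k n] by auto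
    have "A 0 = 0" "B 0 = 0"
      using AB by (simp_all add: in_algebra_def bop_clinear cvp.linear_0)
    then have "(T ^^ k) (A x) = 0" "(F ^^ n) (B x) = 0"
      using AB(1,2) k x(2) funpow_commute[of T A k x] funpow_commute[of F B n x] by (simp_all add: in_algebra_def)
    then have "(G ^^ (k + n)) x = 0"
      by (simp only: AB(3)) simp
    then show "x \<in> hyperkernel T \<inter> hyperkernel G"
      using x(1) hyperkernel_eq[of G] by blast
  qed
  ultimately show ?thesis
    by (rule fin_mod_mono[OF _ order_refl])
qed

lemma fin_mod_closure_hyperkernel_T:
  "fin_mod (closure (hyperkernel T)) (closure (hyperkernel T) \<inter> closure (hyperkernel G))"
proof (rule fin_mod_mono[OF _ order_refl])
  show "fin_mod (closure (hyperkernel T)) (closure (hyperkernel T \<inter> hyperkernel G))"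
    by (intro fin_mod_closure fin_mod_hyperkernel_T cvs.subspace_inter csubspace_hyperkernel lin)
  show "closure (hyperkernel T \<inter> hyperkernel G) \<subseteq> closure (hyperkernel T) \<inter> closure (hyperkernel G)"
    by (simp add: closure_mono)
qed

end

section \<open>Assembly of the two statements\<close>

theorem theorem2p15:
  fixes F :: "'a::complex_banach \<Rightarrow> 'a"
  assumes inf_dim: "\<not> fin_cdim (UNIV :: 'a set)"
    and F_bop: "bop F"
    and F_pow: "\<exists>n. fin_cdim (range (F ^^ n))"
  shows
    "(\<forall>T. bop T \<and> sbf T \<and> T \<circ> F = F \<circ> T \<longrightarrow>
        qdim {x + y | x y. x \<in> hyperrange T \<and> y \<in> hyperrange (\<lambda>z. T z + F z)}
             (hyperrange T \<inter> hyperrange (\<lambda>z. T z + F z)) < \<infinity>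
      \<and> qdim {x + y | x y. x \<in> closure (hyperkernel T) \<and>
                         y \<in> closure (hyperkernel (\<lambda>z. T z + F z))}
             (closure (hyperkernel T) \<inter> closure (hyperkernel (\<lambda>z. T z + F z))) < \<infinity>)
   \<and> (\<forall>T. bop T \<and> T \<circ> F = F \<circ> T \<longrightarrow>
        (upper_sbf T \<longrightarrow> upper_sbf (\<lambda>z. T z + F z) \<and> bind (\<lambda>z. T z + F z) = bind T)
      \<and> (lower_sbf T \<longrightarrow> lower_sbf (\<lambda>z. T z + F z) \<and> bind (\<lambda>z. T z + F z) = bind T))"
proof -
  obtain n where n: "fin_cdim (range (F ^^ n))"
    using F_pow by blast
  have pert: "commuting_perturbation T F n" if "bop T" "T \<circ> F = F \<circ> T" for T
    by (rule commuting_perturbation.intro[OF that(1) F_bop comp_eq_dest[OF that(2)] n])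
  have "qdim {x + y | x y. x \<in> hyperrange T \<and> y \<in> hyperrange (\<lambda>z. T z + F z)}
          (hyperrange T \<inter> hyperrange (\<lambda>z. T z + F z)) < \<infinity>
      \<and> qdim {x + y | x y. x \<in> closure (hyperkernel T) \<and> y \<in> closure (hyperkernel (\<lambda>z. T z + F z))}
          (closure (hyperkernel T) \<inter> closure (hyperkernel (\<lambda>z. T z + F z))) < \<infinity>"
    if T: "bop T" "T \<circ> F = F \<circ> T" for T
  proof -
    interpret commuting_perturbation T F n
      using T by (rule pert)
    \<comment> \<open>The exchanged interpretation supplies the finite-codimension statements for
      the other operator of each pair.\<close>
    interpret sw: commuting_perturbation G "\<lambda>z. - F z" n
      by (rule swap)
    show ?thesis
      unfolding G_def[symmetric]
      using fin_mod_hyperrange_G sw.fin_mod_hyperrange_G[unfolded swap_G]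
        fin_mod_closure_hyperkernel_T sw.fin_mod_closure_hyperkernel_T[unfolded swap_G]
      by (intro conjI qdim_sum_Int_finite csubspace_hyperrange csubspace_closure csubspace_hyperkernel lin)
        (simp_all only: Int_commute)
  qed
  moreover have "(upper_sbf T \<longrightarrow> upper_sbf (\<lambda>z. T z + F z) \<and> bind (\<lambda>z. T z + F z) = bind T)
      \<and> (lower_sbf T \<longrightarrow> lower_sbf (\<lambda>z. T z + F z) \<and> bind (\<lambda>z. T z + F z) = bind T)"
    if T: "bop T" "T \<circ> F = F \<circ> T" for T
  proof -
    interpret commuting_perturbation T F n
      using T by (rule pert)
    show ?thesis
      using upper_sbf_G lower_sbf_G bind_G by (simp add: G_def[symmetric] sbf_def)
  qed
  ultimately show ?thesis
    by simp
qed

end
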